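(* Let $p$ and $q$ be distinct primes with $pq\neq 6$ and $q^2\mid p-1$. Let $r$ be an integer whose multiplicative order modulo $p$ is $q^{2}$, and let $G=\langle a,b,c\mid a^{q^{2}}=b^{p}=c^{p}=[b,c]=1,\ a^{-1}ba=b^{r},\ a^{-1}ca=c^{r^{-1}}\rangle$, where $r^{-1}$ is an inverse of $r$ modulo $p$. Then $\mathrm{Aut}(G)\simeq(\mathbb{Z}_{p}\times\mathbb{Z}_{p})\rtimes((\mathbb{Z}_{p-1}\times\mathbb{Z}_{p-1})\rtimes\mathbb{Z}_{2})$.
   Context: $\mathbb{Z}_n$ is the cyclic group of order $n$; $[x,y]=x^{-1}y^{-1}xy$. $X\rtimes Y$ denotes a semidirect product with normal subgroup $X$ with respect to some homomorphism $Y\to\mathrm{Aut}(X)$; the statement asserts that $\mathrm{Aut}(G)$ is isomorphic to such an (iterated) semidirect product for some choice of actions. *)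

theory Defs
  imports "HOL-Algebra.Elementary_Groups" "HOL-Algebra.Bij" "HOL-Number_Theory.Number_Theory"
begin

section \<open>Free groups and group presentations\<close>

text \<open>A word over the generators \<open>'g\<close>: the letter \<open>(x, True)\<close> stands for \<open>x\<close> and
  \<open>(x, False)\<close> for its formal inverse.\<close>

type_synonym 'g word = "('g \<times> bool) list"

inductive cancels :: "'g word \<Rightarrow> 'g word \<Rightarrow> bool" where
  "cancels (u @ [(x, e), (x, \<not> e)] @ v) (u @ v)"

definition word_rel :: "('g word \<times> 'g word) set" where
  "word_rel = {(u, v). equivclp cancels u v}"

definition free_group :: "'g word set monoid" where
  "free_group =
    \<lparr>carrier = UNIV // word_rel,
     monoid.mult = (\<lambda>U V. \<Union>u\<in>U. \<Union>v\<in>V. word_rel `` {u @ v}),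
     one = word_rel `` {[]}\<rparr>"

definition free_gen :: "'g \<Rightarrow> 'g word set" where
  "free_gen x = word_rel `` {[(x, True)]}"

definition normal_closure :: "('a, 'b) monoid_scheme \<Rightarrow> 'a set \<Rightarrow> 'a set" where
  "normal_closure G S = \<Inter>{N. N \<lhd> G \<and> S \<subseteq> N}"

text \<open>The group on the generators \<open>'g\<close> with defining relations \<open>u = v\<close> for \<open>(u, v) \<in> E\<close>.\<close>

definition presented_group :: "('g word set \<times> 'g word set) set \<Rightarrow> 'g word set set monoid" where
  "presented_group E =
    free_group Mod
      normal_closure free_group {u \<otimes>\<^bsub>free_group\<^esub> inv\<^bsub>free_group\<^esub> v | u v. (u, v) \<in> E}"

definition commutator :: "('a, 'b) monoid_scheme \<Rightarrow> 'a \<Rightarrow> 'a \<Rightarrow> 'a" where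
  "commutator G x y = inv\<^bsub>G\<^esub> x \<otimes>\<^bsub>G\<^esub> inv\<^bsub>G\<^esub> y \<otimes>\<^bsub>G\<^esub> x \<otimes>\<^bsub>G\<^esub> y"


section \<open>The group in question\<close>

datatype gen = GenA | GenB | GenC

text \<open>The parameter \<open>s\<close> plays the role of \<open>r\<^sup>-\<^sup>1\<close>, an inverse of \<open>r\<close> modulo \<open>p\<close>.\<close>

definition G_group :: "nat \<Rightarrow> nat \<Rightarrow> int \<Rightarrow> int \<Rightarrow> gen word set set monoid" where
  "G_group p q r s =
    (let F = free_group; a = free_gen GenA; b = free_gen GenB; c = free_gen GenC
     in presented_group
         {(a [^]\<^bsub>F\<^esub> (q ^ 2), \<one>\<^bsub>F\<^esub>),
          (b [^]\<^bsub>F\<^esub> p, \<one>\<^bsub>F\<^esub>),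
          (c [^]\<^bsub>F\<^esub> p, \<one>\<^bsub>F\<^esub>),
          (commutator F b c, \<one>\<^bsub>F\<^esub>),
          (inv\<^bsub>F\<^esub> a \<otimes>\<^bsub>F\<^esub> b \<otimes>\<^bsub>F\<^esub> a, b [^]\<^bsub>F\<^esub> r),
          (inv\<^bsub>F\<^esub> a \<otimes>\<^bsub>F\<^esub> c \<otimes>\<^bsub>F\<^esub> a, c [^]\<^bsub>F\<^esub> s)})"


section \<open>Semidirect products\<close>

text \<open>\<open>semidirect N H \<phi>\<close> has normal factor \<open>N\<close>, on which \<open>H\<close> acts from the left through
  \<open>\<phi> \<in> hom H (AutoGroup N)\<close>; multiplication in \<open>AutoGroup\<close> is composition of functions.\<close>

definition semidirect ::
  "('a, 'm) monoid_scheme \<Rightarrow> ('b, 'n) monoid_scheme \<Rightarrow> ('b \<Rightarrow> 'a \<Rightarrow> 'a) \<Rightarrow> ('a \<times> 'b) monoid" where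
  "semidirect N H \<phi> =
    \<lparr>carrier = carrier N \<times> carrier H,
     monoid.mult = (\<lambda>(x, y) (x', y'). (x \<otimes>\<^bsub>N\<^esub> \<phi> y x', y \<otimes>\<^bsub>H\<^esub> y')),
     one = (\<one>\<^bsub>N\<^esub>, \<one>\<^bsub>H\<^esub>)\<rparr>"

end

theory Submission
  imports Defs
begin

text \<open>Let \<open>n = q\<^sup>2\<close> and \<open>V = \<langle>b, c\<rangle>\<close>. The group \<open>G\<close> is the semidirect product of \<open>V \<cong> \<int>\<^sub>p \<times> \<int>\<^sub>p\<close> and the cyclic
  group generated by \<open>a\<close>; the conjugation \<open>x \<mapsto> a\<^sup>-\<^sup>1 x a\<close> acts on \<open>V\<close> by a diagonal matrix with the entries
  \<open>r\<close> and \<open>s = r\<^sup>-\<^sup>1\<close>. As \<open>r\<close> has order \<open>n > 2\<close>, these two eigenvalues are distinct. Let \<open>F\<close> be an automorphism. It maps \<open>V\<close> to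
  itself, because \<open>n\<close> is prime to \<open>p\<close> and so \<open>V\<close> is the set of elements of order dividing \<open>p\<close>, and \<open>F a\<close> lies over some power \<open>a\<^sup>k\<close>.
  Applying \<open>F\<close> to the relations shows that \<open>F b\<close> and \<open>F c\<close> are eigenvectors of \<open>a\<^sup>k\<close> with eigenvalues \<open>r\<close>
  and \<open>s\<close>. So either \<open>k = 1\<close> and \<open>F\<close> acts on \<open>V\<close> by a diagonal matrix, or \<open>k = - 1\<close> and it acts by an
  antidiagonal one (\<open>auto_K_cases\<close>). Conversely every monomial matrix extends to an automorphism that fixes
  or inverts \<open>a\<close> (\<open>extend_hom\<close>).

  What remains free is the component of \<open>F a\<close> in \<open>V\<close>. No power \<open>a\<^sup>k\<close> with \<open>k = \<plusminus> 1\<close> has eigenvalue 1, so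
  each such component is produced by conjugation with exactly one element of \<open>V\<close>. Hence the automorphism
  group is the semidirect product of \<open>V\<close>, acting by inner automorphisms, and the group of monomial
  matrices acting naturally on \<open>V\<close> (\<open>Theta_hom\<close>, \<open>Theta_inj\<close>, \<open>Theta_surj\<close>). The latter is the semidirect
  product of the diagonal matrices, which a primitive root modulo \<open>p\<close> identifies with
  \<open>\<int>\<^bsub>p-1\<^esub> \<times> \<int>\<^bsub>p-1\<^esub>\<close>, and the swap of the two coordinates.

  The argument takes place in a concrete model \<open>K\<close> of the semidirect product. That the presentation
  defines this group (\<open>G_group_iso_K\<close>) follows from the universal properties of both sides.\<close>

section \<open>Free groups and presentations\<close>

lemma equiv_word_rel: "equiv UNIV word_rel"
  by (rule equivI) (auto simp: word_rel_def refl_on_def intro!: symI transI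
      intro: equivclp_sym equivclp_trans)

lemma cancels_append: "cancels u v \<Longrightarrow> cancels (x @ u @ y) (x @ v @ y)"
proof (induction rule: cancels.induct)
  case (1 u z e v)
  show ?case
    using cancels.intros[of "x @ u" z e "v @ y"] by simp
qed

lemma word_rel_context: "(u, v) \<in> word_rel \<Longrightarrow> (x @ u @ y, x @ v @ y) \<in> word_rel"
  unfolding word_rel_def mem_Collect_eq case_prod_conv
proof (induction rule: equivclp_induct)
  case base
  show ?case by simp
next
  case (step v w)
  from step(2) have "cancels (x @ v @ y) (x @ w @ y) \<or> cancels (x @ w @ y) (x @ v @ y)"
    by (auto intro: cancels_append)
  with step(3) show ?case
    by (meson equivclp_into_equivclp)
qed

lemma word_rel_append:
  assumes "(u, u') \<in> word_rel" "(v, v') \<in> word_rel"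
  shows "(u @ v, u' @ v') \<in> word_rel"
proof -
  have "(u @ v, u' @ v) \<in> word_rel" "(u' @ v, u' @ v') \<in> word_rel"
    using word_rel_context[OF assms(1), of "[]" v] word_rel_context[OF assms(2), of u' "[]"] by simp_all
  then show ?thesis
    using equiv_word_rel by (meson equivE transD)
qed

abbreviation word_class :: "'g word \<Rightarrow> 'g word set" where
  "word_class w \<equiv> word_rel `` {w}"

lemma word_class_eq_iff: "word_class u = word_class v \<longleftrightarrow> (u, v) \<in> word_rel"
  using eq_equiv_class_iff[OF equiv_word_rel] by auto

lemma carrier_free_group: "carrier free_group = range word_class"
  by (auto simp: free_group_def quotient_def)

lemma one_free_group: "\<one>\<^bsub>free_group\<^esub> = word_class []"
  by (simp add: free_group_def)

lemma mult_word_class: "word_class u \<otimes>\<^bsub>free_group\<^esub> word_class v = word_class (u @ v)"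
proof -
  have "word_class (u' @ v') = word_class (u @ v)" if "u' \<in> word_class u" "v' \<in> word_class v" for u' v'
    using that word_rel_append[of u u' v v'] by (simp add: word_class_eq_iff[symmetric])
  moreover have "u \<in> word_class u" "v \<in> word_class v"
    using equiv_word_rel by (auto simp: equiv_def refl_on_def)
  ultimately have "(\<Union>u'\<in>word_class u. \<Union>v'\<in>word_class v. word_class (u' @ v')) = word_class (u @ v)"
    by blast
  then show ?thesis
    by (simp add: free_group_def)
qed

text \<open>Reversing a word and flipping the signs of its letters gives a formal inverse; the cancellation
  works from the inside out.\<close>

lemma cancel_inverse_word: "(map (\<lambda>(x, e). (x, \<not> e)) (rev w) @ w, []) \<in> word_rel"
proof (induction w)
  case Nil
  then show ?case by (simp add: word_rel_def)
next
  case (Cons z w)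
  obtain x e where z: "z = (x, e)" by force
  let ?i = "map (\<lambda>(x, e). (x, \<not> e))"
  have "cancels (?i (rev w) @ [(x, \<not> e), (x, \<not> \<not> e)] @ w) (?i (rev w) @ w)"
    by (rule cancels.intros)
  then have "(?i (rev (z # w)) @ z # w, ?i (rev w) @ w) \<in> word_rel"
    by (auto simp: word_rel_def z)
  then show ?case
    using Cons equiv_word_rel by (meson equivE transD)
qed

lemma group_free_group: "group free_group"
proof (rule groupI)
  fix x :: "'g word set"
  assume "x \<in> carrier free_group"
  then obtain w where w: "x = word_class w" by (auto simp: carrier_free_group)
  show "\<exists>y\<in>carrier free_group. y \<otimes>\<^bsub>free_group\<^esub> x = \<one>\<^bsub>free_group\<^esub>"
    using cancel_inverse_word[of w]
    by (intro bexI[of _ "word_class (map (\<lambda>(x, e). (x, \<not> e)) (rev w))"])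
       (auto simp: w mult_word_class one_free_group word_class_eq_iff carrier_free_group)
qed (auto simp: carrier_free_group mult_word_class one_free_group)

lemma free_gen_closed: "free_gen x \<in> carrier free_group"
  by (simp add: carrier_free_group free_gen_def)

lemma inv_free_gen: "inv\<^bsub>free_group\<^esub> (free_gen x) = word_class [(x, False)]"
proof (rule group.inv_equality[OF group_free_group])
  show "word_class [(x, False)] \<otimes>\<^bsub>free_group\<^esub> free_gen x = \<one>\<^bsub>free_group\<^esub>"
    using cancel_inverse_word[of "[(x, True)]"]
    by (simp add: free_gen_def mult_word_class one_free_group word_class_eq_iff)
qed (auto simp: carrier_free_group free_gen_def)

definition word_val :: "('a, 'm) monoid_scheme \<Rightarrow> ('g \<Rightarrow> 'a) \<Rightarrow> 'g word \<Rightarrow> 'a" where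
  "word_val H f w = foldr (\<lambda>(x, e) y. (if e then f x else inv\<^bsub>H\<^esub> f x) \<otimes>\<^bsub>H\<^esub> y) w \<one>\<^bsub>H\<^esub>"

text \<open>Evaluation of words respects concatenation and kills every pair of adjacent inverse letters, so
  it descends to classes of words.\<close>

lemma free_group_universal:
  assumes "group H" and f: "\<And>x. f x \<in> carrier H"
  obtains h where "h \<in> hom free_group H" "\<And>x. h (free_gen x) = f x"
proof -
  interpret H: group H by fact
  let ?v = "word_val H f"
  have closed: "?v w \<in> carrier H" for w
    by (induction w) (auto simp: word_val_def f)
  have app: "?v (u @ w) = ?v u \<otimes>\<^bsub>H\<^esub> ?v w" for u w
  proof (induction u)
    case Nil
    then show ?case using closed[of w] by (simp add: word_val_def)
  next
    case (Cons z u)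
    then show ?case using closed[of u] closed[of w] f
      by (auto simp: word_val_def H.m_assoc split: prod.splits)
  qed
  have cancels_val: "?v u = ?v w" if "cancels u w" for u w
    using that
  proof induction
    case (1 u x e v)
    have "?v [(x, e), (x, \<not> e)] = \<one>\<^bsub>H\<^esub>"
      using f[of x] by (cases e) (auto simp: word_val_def)
    then show ?case
      by (simp only: app) (simp add: closed)
  qed
  have val: "?v u = ?v w" if "(u, w) \<in> word_rel" for u w
  proof -
    have "equivclp cancels u w"
      using that by (simp add: word_rel_def)
    then show ?thesis
      by (induction rule: equivclp_induct) (auto dest: cancels_val)
  qed
  define h where "h U = ?v (SOME w. w \<in> U)" for U
  have h: "h (word_class w) = ?v w" for w
  proof -
    have "w \<in> word_class w"
      using equiv_word_rel by (auto simp: equiv_def refl_on_def)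
    then have "(SOME u. u \<in> word_class w) \<in> word_class w"
      by (rule someI)
    then show ?thesis
      using val unfolding h_def by auto
  qed
  show thesis
  proof
    show "h \<in> hom free_group H"
      by (rule homI) (auto simp: carrier_free_group mult_word_class h app closed)
    show "h (free_gen x) = f x" for x
      using f by (simp add: free_gen_def h word_val_def)
  qed
qed

lemma hom_free_group_eq:
  assumes H: "group H" and h: "h \<in> hom free_group H" "h' \<in> hom free_group H"
    and gen: "\<And>x. h (free_gen x) = h' (free_gen x)" and "u \<in> carrier free_group"
  shows "h u = h' u"
proof -
  interpret h: group_hom free_group H h
    using group_free_group H h by (simp add: group_hom_def group_hom_axioms_def)
  interpret h': group_hom free_group H h'
    using group_free_group H h by (simp add: group_hom_def group_hom_axioms_def)
  have letter: "h (word_class [(x, e)]) = h' (word_class [(x, e)])" for x e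
  proof (cases e)
    case True
    then show ?thesis using gen[of x] by (simp add: free_gen_def)
  next
    case False
    then show ?thesis using gen[of x] free_gen_closed[of x] by (simp flip: inv_free_gen)
  qed
  have "h (word_class w) = h' (word_class w)" for w
  proof (induction w)
    case Nil
    then show ?case using h.hom_one h'.hom_one by (simp add: one_free_group)
  next
    case (Cons z w)
    obtain x e where "z = (x, e)" by force
    then have "word_class (z # w) = word_class [(x, e)] \<otimes>\<^bsub>free_group\<^esub> word_class w"
      by (simp add: mult_word_class)
    then show ?case
      by (simp add: Cons letter carrier_free_group)
  qed
  then show ?thesis
    using assms(5) by (auto simp: carrier_free_group)
qed

lemma (in group) normal_normal_closure:
  assumes "S \<subseteq> carrier G"
  shows "normal_closure G S \<lhd> G"
proof -
  have "carrier G \<lhd> G"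
    by (simp add: normal_inv_iff subgroup_self)
  then have "carrier G \<in> {N. N \<lhd> G \<and> S \<subseteq> N}"
    using assms by simp
  then have "subgroup (normal_closure G S) G"
    unfolding normal_closure_def
    by (intro subgroups_Inter) (auto dest: normal_imp_subgroup)
  moreover have "x \<otimes> h \<otimes> inv x \<in> normal_closure G S"
    if "x \<in> carrier G" "h \<in> normal_closure G S" for x h
    using that by (auto simp: normal_closure_def normal_inv_iff)
  ultimately show ?thesis
    by (simp add: normal_inv_iff)
qed

definition relators :: "('g word set \<times> 'g word set) set \<Rightarrow> 'g word set set" where
  "relators E = {u \<otimes>\<^bsub>free_group\<^esub> inv\<^bsub>free_group\<^esub> v | u v. (u, v) \<in> E}"

lemma presented_group_eq:
  "presented_group E = free_group Mod normal_closure free_group (relators E)"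
  unfolding presented_group_def relators_def by (rule refl)

definition presented_class :: "('g word set \<times> 'g word set) set \<Rightarrow> 'g word set \<Rightarrow> 'g word set set" where
  "presented_class E u = normal_closure free_group (relators E) #>\<^bsub>free_group\<^esub> u"

context
  fixes E :: "('g word set \<times> 'g word set) set"
  assumes E: "\<And>u v. (u, v) \<in> E \<Longrightarrow> u \<in> carrier free_group \<and> v \<in> carrier free_group"
begin

interpretation F: group "free_group :: 'g word set monoid"
  by (rule group_free_group)

lemma relators_subset: "relators E \<subseteq> carrier free_group"
  using E unfolding relators_def by (blast intro: F.m_closed F.inv_closed)

interpretation N: normal "normal_closure free_group (relators E)" free_group
  by (rule F.normal_normal_closure[OF relators_subset])

lemma group_presented_group: "group (presented_group E)"
  unfolding presented_group_eq by (rule N.factorgroup_is_group)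

lemma carrier_presented_group: "carrier (presented_group E) = presented_class E ` carrier free_group"
  unfolding presented_group_eq carrier_FactGroup presented_class_def by (rule refl)

lemma hom_presented_class: "presented_class E \<in> hom free_group (presented_group E)"
  using N.r_coset_hom_Mod unfolding presented_group_eq presented_class_def .

lemma presented_class_relation:
  assumes "(u, v) \<in> E"
  shows "presented_class E u = presented_class E v"
proof -
  have uv: "u \<in> carrier free_group" "v \<in> carrier free_group"
    using E[OF assms] by blast+
  have "u \<otimes>\<^bsub>free_group\<^esub> inv\<^bsub>free_group\<^esub> v \<in> normal_closure free_group (relators E)"
    using assms unfolding normal_closure_def relators_def by blast
  then have "u \<in> presented_class E v"
    unfolding presented_class_def
    using uv F.group_axioms N.rcos_module_rev by blast
  then show ?thesis
    unfolding presented_class_def using uv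
    by (metis F.repr_independence N.subgroup_axioms)
qed

text \<open>Von Dyck's theorem: the kernel of a homomorphism that respects the relations is a normal subgroup
  containing all relators, hence contains their normal closure.\<close>

lemma presented_group_universal:
  assumes H: "group H" and h: "h \<in> hom free_group H"
    and rel: "\<And>u v. (u, v) \<in> E \<Longrightarrow> h u = h v"
  obtains k where "k \<in> hom (presented_group E) H"
    "\<And>u. u \<in> carrier free_group \<Longrightarrow> k (presented_class E u) = h u"
proof -
  interpret h: group_hom free_group H h
    using group_free_group H h by (simp add: group_hom_def group_hom_axioms_def)
  have "relators E \<subseteq> kernel free_group H h"
    using E by (auto simp: relators_def kernel_def rel)
  then have "normal_closure free_group (relators E) \<subseteq> kernel free_group H h"
    using h.normal_kernel unfolding normal_closure_def by blast
  then show thesis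
    using h.FactGroup_universal_kernel[OF N.normal_axioms] that
    unfolding presented_group_eq presented_class_def by metis
qed

lemma hom_presented_group_eq:
  assumes H: "group H" and k: "k \<in> hom (presented_group E) H" "k' \<in> hom (presented_group E) H"
    and gen: "\<And>x. k (presented_class E (free_gen x)) = k' (presented_class E (free_gen x))"
    and x: "x \<in> carrier (presented_group E)"
  shows "k x = k' x"
proof -
  have "k \<circ> presented_class E \<in> hom free_group H" "k' \<circ> presented_class E \<in> hom free_group H"
    using k hom_presented_class hom_compose by blast+
  note eq = hom_free_group_eq[OF H this]
  have "(k \<circ> presented_class E) u = (k' \<circ> presented_class E) u" if "u \<in> carrier free_group" for u
    by (rule eq[OF _ that]) (simp add: gen)
  then show ?thesis
    using x by (auto simp: carrier_presented_group)
qed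

end

section \<open>Powers with reduced exponents\<close>

text \<open>Exponents matter only modulo \<open>n\<close>; negative exponents are included, since the parameters \<open>r\<close>
  and \<open>s\<close> of the presentation are arbitrary integers.\<close>

lemma (in group) int_pow_mod:
  assumes "x \<in> carrier G" "x [^] (n :: nat) = \<one>"
  shows "x [^] (i mod int n) = x [^] i"
proof -
  have "x [^] (int n * (i div int n)) = \<one>"
    using assms by (simp add: int_pow_int flip: int_pow_pow)
  then have "x [^] (int n * (i div int n) + i mod int n) = x [^] (i mod int n)"
    using assms by (simp only: int_pow_mult) simp
  then show ?thesis by simp
qed

lemma (in group) hom_integer_mod_group:
  assumes "x \<in> carrier G" "x [^] (n :: nat) = \<one>"
  shows "(\<lambda>i. x [^] i) \<in> hom (integer_mod_group n) G"
  using assms by (intro homI) (auto simp: int_pow_mod int_pow_mult)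

section \<open>Automorphism groups\<close>

lemma carrier_AutoGroup: "carrier (AutoGroup G) = auto G"
  by (simp add: AutoGroup_def)

lemma mult_AutoGroup:
  "f \<in> auto G \<Longrightarrow> g \<in> auto G \<Longrightarrow> f \<otimes>\<^bsub>AutoGroup G\<^esub> g = compose (carrier G) f g"
  by (simp add: AutoGroup_def BijGroup_def auto_def)

lemma one_AutoGroup: "\<one>\<^bsub>AutoGroup G\<^esub> = (\<lambda>x\<in>carrier G. x)"
  by (simp add: AutoGroup_def BijGroup_def)

lemma autoD:
  assumes "f \<in> auto G"
  shows "f \<in> hom G G" "f \<in> extensional (carrier G)" "bij_betw f (carrier G) (carrier G)"
    "inj_on f (carrier G)" "x \<in> carrier G \<Longrightarrow> f x \<in> carrier G"
    "x \<in> carrier G \<Longrightarrow> y \<in> carrier G \<Longrightarrow> f (x \<otimes>\<^bsub>G\<^esub> y) = f x \<otimes>\<^bsub>G\<^esub> f y"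
  using assms by (auto simp: auto_def Bij_def hom_def bij_betw_def)

lemma autoI:
  assumes "f \<in> hom G G" "f \<in> extensional (carrier G)" "bij_betw f (carrier G) (carrier G)"
  shows "f \<in> auto G"
  using assms by (auto simp: auto_def Bij_def)

lemma auto_eqI:
  assumes "f \<in> auto G" "g \<in> auto G" "\<And>x. x \<in> carrier G \<Longrightarrow> f x = g x"
  shows "f = g"
  using assms extensionalityI autoD(2) by metis

lemma hom_AutoGroupI:
  assumes c: "\<And>t. t \<in> carrier H \<Longrightarrow> m t \<in> auto G"
    and e: "\<And>t t' v. t \<in> carrier H \<Longrightarrow> t' \<in> carrier H \<Longrightarrow> v \<in> carrier G \<Longrightarrow>
      m (t \<otimes>\<^bsub>H\<^esub> t') v = m t (m t' v)"
    and H: "group H"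
  shows "m \<in> hom H (AutoGroup G)"
proof (rule homI)
  interpret H: group H by fact
  fix t t' assume t: "t \<in> carrier H" "t' \<in> carrier H"
  have "m (t \<otimes>\<^bsub>H\<^esub> t') \<in> extensional (carrier G)"
    using t autoD(2)[OF c] by simp
  then show "m (t \<otimes>\<^bsub>H\<^esub> t') = m t \<otimes>\<^bsub>AutoGroup G\<^esub> m t'"
    unfolding mult_AutoGroup[OF c c, OF t]
    using t by (auto intro!: extensionalityI[of _ "carrier G"] simp: compose_def e)
qed (simp add: c carrier_AutoGroup)

text \<open>Conjugating automorphisms by an isomorphism transports the automorphism group. This allows the
  presented group to be replaced by a concrete model.\<close>

lemma AutoGroup_iso_cong:
  assumes "group G" "group K" "G \<cong> K"
  shows "AutoGroup G \<cong> AutoGroup K"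
proof -
  obtain h where h: "h \<in> iso G K"
    using assms(3) by (auto simp: is_iso_def)
  define k where "k = inv_into (carrier G) h"
  have k: "k \<in> iso K G"
    using group.iso_set_sym[OF assms(1) h] by (simp add: k_def)
  have kh: "k (h x) = x" if "x \<in> carrier G" for x
    using h that by (auto simp: k_def iso_def intro: bij_betw_inv_into_left)
  have hk: "h (k x) = x" if "x \<in> carrier K" for x
    using h that by (auto simp: k_def iso_def intro: bij_betw_inv_into_right)
  have hc: "h x \<in> carrier K" if "x \<in> carrier G" for x
    using h that by (auto simp: iso_def hom_def)
  have kc: "k x \<in> carrier G" if "x \<in> carrier K" for x
    using k that by (auto simp: iso_def hom_def)
  have conj: "restrict (h \<circ> f \<circ> k) (carrier K) \<in> auto K"
    if "group K" and f: "f \<in> auto G" and hk: "h \<in> iso G K" "k \<in> iso K G"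
    for f h k and G :: "('x, 'm) monoid_scheme" and K :: "('y, 'n) monoid_scheme"
  proof (rule autoI)
    have "f \<in> iso G G"
      using autoD[OF f] by (simp add: iso_def)
    then have *: "h \<circ> f \<circ> k \<in> iso K K"
      using iso_set_trans[OF hk(2) iso_set_trans[OF _ hk(1)]] by simp
    then have "restrict (h \<circ> f \<circ> k) (carrier K) \<in> iso K K"
      by (rule group.iso_eq[OF \<open>group K\<close>]) simp
    then show "restrict (h \<circ> f \<circ> k) (carrier K) \<in> hom K K"
      "bij_betw (restrict (h \<circ> f \<circ> k) (carrier K)) (carrier K) (carrier K)"
      by (auto simp: iso_def)
  qed simp
  let ?c = "\<lambda>f. restrict (h \<circ> f \<circ> k) (carrier K)"
  let ?d = "\<lambda>f. restrict (k \<circ> f \<circ> h) (carrier G)"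
  have "?c \<in> hom (AutoGroup G) (AutoGroup K)"
  proof (rule homI)
    fix f g assume fg: "f \<in> carrier (AutoGroup G)" "g \<in> carrier (AutoGroup G)"
    then have *: "?c f \<in> auto K" "?c g \<in> auto K"
      by (simp_all add: conj assms(1,2) h k carrier_AutoGroup)
    show "?c (f \<otimes>\<^bsub>AutoGroup G\<^esub> g) = ?c f \<otimes>\<^bsub>AutoGroup K\<^esub> ?c g"
      unfolding mult_AutoGroup[OF *]
      using fg kc hc autoD(5)[of g G]
      by (auto simp: carrier_AutoGroup mult_AutoGroup compose_def restrict_def fun_eq_iff kh)
  qed (simp add: conj assms(1,2) h k carrier_AutoGroup)
  moreover have "bij_betw ?c (carrier (AutoGroup G)) (carrier (AutoGroup K))"
  proof (rule bij_betw_byWitness[where f' = ?d])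
    have "?d (?c f) = f" if "f \<in> auto G" for f
      using that h k hc kc autoD(5)[OF that] by (intro auto_eqI[OF conj]) (auto simp: assms(1,2) conj kh)
    then show "\<forall>f\<in>carrier (AutoGroup G). ?d (?c f) = f"
      by (simp add: carrier_AutoGroup)
    have "?c (?d f) = f" if "f \<in> auto K" for f
      using that h k hc kc autoD(5)[OF that] by (intro auto_eqI[OF conj]) (auto simp: assms(1,2) conj hk)
    then show "\<forall>f\<in>carrier (AutoGroup K). ?c (?d f) = f"
      by (simp add: carrier_AutoGroup)
  qed (auto simp: carrier_AutoGroup conj assms(1,2) h k)
  ultimately show ?thesis
    by (meson is_isoI isoI)
qed

definition conjugation :: "('a, 'm) monoid_scheme \<Rightarrow> 'a \<Rightarrow> 'a \<Rightarrow> 'a" where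
  "conjugation G x = (\<lambda>z\<in>carrier G. x \<otimes>\<^bsub>G\<^esub> z \<otimes>\<^bsub>G\<^esub> inv\<^bsub>G\<^esub> x)"

lemma (in group) conjugation_auto:
  assumes "x \<in> carrier G"
  shows "conjugation G x \<in> auto G"
proof (rule autoI)
  have cancel: "inv x \<otimes> (x \<otimes> z) = z" "x \<otimes> (inv x \<otimes> z) = z" if "z \<in> carrier G" for z
    using assms that by (simp_all flip: m_assoc)
  have "x \<otimes> (z \<otimes> w) \<otimes> inv x = x \<otimes> z \<otimes> inv x \<otimes> (x \<otimes> w \<otimes> inv x)"
    if "z \<in> carrier G" "w \<in> carrier G" for z w
    using assms that by (simp add: m_assoc cancel)
  then show "conjugation G x \<in> hom G G"
    using assms by (auto intro!: homI simp: conjugation_def)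
  show "bij_betw (conjugation G x) (carrier G) (carrier G)"
    by (rule bij_betw_byWitness[where f' = "\<lambda>z. inv x \<otimes> z \<otimes> x"])
       (use assms in \<open>auto simp: conjugation_def m_assoc cancel\<close>)
qed (simp add: conjugation_def)

lemma (in group) conjugation_hom: "conjugation G \<in> hom G (AutoGroup G)"
proof (rule homI)
  fix x y assume xy: "x \<in> carrier G" "y \<in> carrier G"
  show "conjugation G (x \<otimes> y) = conjugation G x \<otimes>\<^bsub>AutoGroup G\<^esub> conjugation G y"
    unfolding mult_AutoGroup[OF xy[THEN conjugation_auto]]
    using xy by (auto simp: conjugation_def compose_def restrict_def fun_eq_iff m_assoc inv_mult_group)
qed (simp add: carrier_AutoGroup conjugation_auto)

text \<open>Automorphisms normalise the inner automorphisms and permute them as they permute the elements;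
  this gives the outermost semidirect product in the automorphism group.\<close>

lemma (in group) auto_conjugation:
  assumes F: "F \<in> auto G" and x: "x \<in> carrier G"
  shows "F \<otimes>\<^bsub>AutoGroup G\<^esub> conjugation G x = conjugation G (F x) \<otimes>\<^bsub>AutoGroup G\<^esub> F"
proof -
  interpret F: group_hom G G F
    using autoD(1)[OF F] by unfold_locales
  have "F \<otimes>\<^bsub>AutoGroup G\<^esub> conjugation G x = compose (carrier G) F (conjugation G x)"
    "conjugation G (F x) \<otimes>\<^bsub>AutoGroup G\<^esub> F = compose (carrier G) (conjugation G (F x)) F"
    using x F by (auto intro!: mult_AutoGroup conjugation_auto)
  then show ?thesis
    using x by (auto simp: conjugation_def compose_def restrict_def fun_eq_iff)
qed

lemma (in group) int_pow_conjugate: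
  assumes "x \<in> carrier G" "y \<in> carrier G" "z \<in> carrier G" and "x \<otimes> y = z \<otimes> x"
  shows "x \<otimes> y [^] (i :: int) = z [^] i \<otimes> x"
proof -
  interpret c: group_hom G G "conjugation G x"
    using conjugation_auto[OF assms(1)] by (unfold_locales) (rule autoD(1))
  have "conjugation G x y = z"
    using assms by (simp add: conjugation_def m_assoc)
  then have "x \<otimes> y [^] i \<otimes> inv x = z [^] i"
    using assms c.hom_int_pow[of y i] by (simp add: conjugation_def)
  then show ?thesis
    using assms by (metis int_pow_closed inv_solve_right' m_closed)
qed

lemma (in group) commutator_eq_one_iff:
  assumes "x \<in> carrier G" "y \<in> carrier G"
  shows "commutator G x y = \<one> \<longleftrightarrow> x \<otimes> y = y \<otimes> x"
proof -
  have "commutator G x y = inv (y \<otimes> x) \<otimes> (x \<otimes> y)"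
    using assms by (simp add: commutator_def inv_mult_group m_assoc)
  then show ?thesis
    using assms by (metis inv_closed inv_equality inv_inv l_inv m_closed)
qed

section \<open>Semidirect products\<close>

lemma carrier_semidirect [simp]: "carrier (semidirect N H \<phi>) = carrier N \<times> carrier H"
  by (simp add: semidirect_def)

lemma mult_semidirect [simp]:
  "(x, y) \<otimes>\<^bsub>semidirect N H \<phi>\<^esub> (x', y') = (x \<otimes>\<^bsub>N\<^esub> \<phi> y x', y \<otimes>\<^bsub>H\<^esub> y')"
  by (simp add: semidirect_def)

lemma one_semidirect [simp]: "\<one>\<^bsub>semidirect N H \<phi>\<^esub> = (\<one>\<^bsub>N\<^esub>, \<one>\<^bsub>H\<^esub>)"
  by (simp add: semidirect_def)

lemma action_facts:
  assumes "group N" "group H" and \<phi>: "\<phi> \<in> hom H (AutoGroup N)"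
  shows "y \<in> carrier H \<Longrightarrow> \<phi> y \<in> auto N"
    and "y \<in> carrier H \<Longrightarrow> y' \<in> carrier H \<Longrightarrow> x \<in> carrier N \<Longrightarrow> \<phi> (y \<otimes>\<^bsub>H\<^esub> y') x = \<phi> y (\<phi> y' x)"
    and "x \<in> carrier N \<Longrightarrow> \<phi> \<one>\<^bsub>H\<^esub> x = x"
proof -
  show auto: "\<phi> y \<in> auto N" if "y \<in> carrier H" for y
    using that \<phi> by (auto simp: hom_def carrier_AutoGroup)
  show "\<phi> (y \<otimes>\<^bsub>H\<^esub> y') x = \<phi> y (\<phi> y' x)"
    if "y \<in> carrier H" "y' \<in> carrier H" "x \<in> carrier N" for y y' x
    using that auto by (simp add: hom_mult[OF \<phi>] mult_AutoGroup compose_def)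
  have "\<phi> \<one>\<^bsub>H\<^esub> = \<one>\<^bsub>AutoGroup N\<^esub>"
    using hom_one[OF \<phi>] assms group.AutoGroup by blast
  then show "x \<in> carrier N \<Longrightarrow> \<phi> \<one>\<^bsub>H\<^esub> x = x"
    by (simp add: one_AutoGroup)
qed

lemma group_semidirect:
  assumes N: "group N" and H: "group H" and \<phi>: "\<phi> \<in> hom H (AutoGroup N)"
  shows "group (semidirect N H \<phi>)"
proof -
  interpret N: group N by fact
  interpret H: group H by fact
  note act = action_facts[OF assms]
  have c: "\<phi> y x \<in> carrier N" if "x \<in> carrier N" "y \<in> carrier H" for x y
    using autoD(5)[OF act(1)] that by blast
  have m: "\<phi> y (x \<otimes>\<^bsub>N\<^esub> x') = \<phi> y x \<otimes>\<^bsub>N\<^esub> \<phi> y x'"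
    if "x \<in> carrier N" "x' \<in> carrier N" "y \<in> carrier H" for x x' y
    using autoD(6)[OF act(1)] that by blast
  show ?thesis
  proof (rule groupI)
    fix z assume "z \<in> carrier (semidirect N H \<phi>)"
    then obtain x y where z: "z = (x, y)" "x \<in> carrier N" "y \<in> carrier H" by auto
    have "\<phi> (inv\<^bsub>H\<^esub> y) (inv\<^bsub>N\<^esub> x) \<otimes>\<^bsub>N\<^esub> \<phi> (inv\<^bsub>H\<^esub> y) x = \<phi> (inv\<^bsub>H\<^esub> y) \<one>\<^bsub>N\<^esub>"
      using z by (simp flip: m)
    also have "\<dots> = \<one>\<^bsub>N\<^esub>"
      using z hom_one[OF autoD(1)[OF act(1)] N N] by simp
    finally show "\<exists>w\<in>carrier (semidirect N H \<phi>). w \<otimes>\<^bsub>semidirect N H \<phi>\<^esub> z = \<one>\<^bsub>semidirect N H \<phi>\<^esub>"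
      using z c by (intro bexI[of _ "(\<phi> (inv\<^bsub>H\<^esub> y) (inv\<^bsub>N\<^esub> x), inv\<^bsub>H\<^esub> y)"]) auto
  qed (auto simp: c m act N.m_assoc H.m_assoc)
qed

text \<open>Homomorphisms out of a semidirect product are glued from homomorphisms on the two factors. The
  compatibility condition says that \<open>\<beta> y\<close> conjugates \<open>\<alpha> x\<close> to \<open>\<alpha> (\<phi> y x)\<close>, which is the only
  relation between the factors. It serves both for mapping the model onto the presented group and for
  mapping the claimed semidirect product to the automorphism group.\<close>

lemma semidirect_hom:
  assumes "group A" "group N"
    and \<alpha>: "\<alpha> \<in> hom N A" and \<beta>: "\<beta> \<in> hom H A"
    and closed: "\<And>x y. x \<in> carrier N \<Longrightarrow> y \<in> carrier H \<Longrightarrow> \<phi> y x \<in> carrier N"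
    and compat: "\<And>x y. x \<in> carrier N \<Longrightarrow> y \<in> carrier H \<Longrightarrow>
      \<beta> y \<otimes>\<^bsub>A\<^esub> \<alpha> x = \<alpha> (\<phi> y x) \<otimes>\<^bsub>A\<^esub> \<beta> y"
  shows "(\<lambda>(x, y). \<alpha> x \<otimes>\<^bsub>A\<^esub> \<beta> y) \<in> hom (semidirect N H \<phi>) A"
proof -
  interpret A: group A by fact
  interpret N: group N by fact
  have c: "\<alpha> x \<in> carrier A" "\<beta> y \<in> carrier A" if "x \<in> carrier N" "y \<in> carrier H" for x y
    using that \<alpha> \<beta> by (auto simp: hom_def)
  have "\<alpha> (x \<otimes>\<^bsub>N\<^esub> \<phi> y x') \<otimes>\<^bsub>A\<^esub> \<beta> (y \<otimes>\<^bsub>H\<^esub> y') = (\<alpha> x \<otimes>\<^bsub>A\<^esub> \<beta> y) \<otimes>\<^bsub>A\<^esub> (\<alpha> x' \<otimes>\<^bsub>A\<^esub> \<beta> y')"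
    if *: "x \<in> carrier N" "y \<in> carrier H" "x' \<in> carrier N" "y' \<in> carrier H" for x y x' y'
  proof -
    have "\<alpha> (x \<otimes>\<^bsub>N\<^esub> \<phi> y x') \<otimes>\<^bsub>A\<^esub> \<beta> (y \<otimes>\<^bsub>H\<^esub> y') = \<alpha> x \<otimes>\<^bsub>A\<^esub> (\<alpha> (\<phi> y x') \<otimes>\<^bsub>A\<^esub> \<beta> y) \<otimes>\<^bsub>A\<^esub> \<beta> y'"
      using * closed[of x' y] c by (simp add: hom_mult[OF \<alpha>] hom_mult[OF \<beta>] A.m_assoc)
    also have "\<dots> = \<alpha> x \<otimes>\<^bsub>A\<^esub> (\<beta> y \<otimes>\<^bsub>A\<^esub> \<alpha> x') \<otimes>\<^bsub>A\<^esub> \<beta> y'"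
      using * by (simp add: compat)
    finally show ?thesis
      using * c by (simp add: A.m_assoc)
  qed
  then show ?thesis
    using c by (auto intro!: homI)
qed

lemma semidirect_inl_hom:
  assumes "group N" "group H" "\<phi> \<in> hom H (AutoGroup N)"
  shows "(\<lambda>x. (x, \<one>\<^bsub>H\<^esub>)) \<in> hom N (semidirect N H \<phi>)"
proof -
  interpret H: group H by fact
  show ?thesis
    by (rule homI) (auto simp: action_facts[OF assms])
qed

lemma semidirect_snd_hom: "snd \<in> hom (semidirect N H \<phi>) H"
  by (rule homI) auto

lemma semidirect_pair_auto:
  assumes N: "group N" and H: "group H" and \<phi>: "\<phi> \<in> hom H (AutoGroup N)"
    and m: "m \<in> auto N" and k: "k \<in> auto H"
    and compat: "\<And>x y. x \<in> carrier N \<Longrightarrow> y \<in> carrier H \<Longrightarrow> m (\<phi> y x) = \<phi> (k y) (m x)"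
  shows "restrict (\<lambda>(x, y). (m x, k y)) (carrier N \<times> carrier H) \<in> auto (semidirect N H \<phi>)"
    (is "?f \<in> _")
proof (rule autoI)
  note act = action_facts[OF N H \<phi>]
  interpret S: group "semidirect N H \<phi>" by (rule group_semidirect[OF N H \<phi>])
  interpret N: group N by fact
  interpret H: group H by fact
  have c: "\<phi> y x \<in> carrier N" if "x \<in> carrier N" "y \<in> carrier H" for x y
    using autoD(5)[OF act(1)] that by blast
  show "?f \<in> hom (semidirect N H \<phi>) (semidirect N H \<phi>)"
    by (rule homI) (auto simp: c compat autoD(5,6)[OF m] autoD(5,6)[OF k])
  have "bij_betw (map_prod m k) (carrier N \<times> carrier H) (carrier N \<times> carrier H)"
    using autoD(3)[OF m] autoD(3)[OF k] by (rule bij_betw_map_prod)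
  moreover have "bij_betw ?f (carrier N \<times> carrier H) (carrier N \<times> carrier H) =
      bij_betw (map_prod m k) (carrier N \<times> carrier H) (carrier N \<times> carrier H)"
    by (rule bij_betw_cong) auto
  ultimately show "bij_betw ?f (carrier (semidirect N H \<phi>)) (carrier (semidirect N H \<phi>))"
    by simp
qed simp

lemma semidirect_pair_hom:
  assumes N: "group N" and H: "group H" and \<phi>: "\<phi> \<in> hom H (AutoGroup N)"
    and m: "m \<in> hom W (AutoGroup N)" and k: "k \<in> hom W (AutoGroup H)"
    and compat: "\<And>w x y. w \<in> carrier W \<Longrightarrow> x \<in> carrier N \<Longrightarrow> y \<in> carrier H \<Longrightarrow>
      m w (\<phi> y x) = \<phi> (k w y) (m w x)"
  shows "(\<lambda>w. restrict (\<lambda>(x, y). (m w x, k w y)) (carrier N \<times> carrier H))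
    \<in> hom W (AutoGroup (semidirect N H \<phi>))" (is "?f \<in> _")
proof (rule homI)
  have mk: "m w \<in> auto N" "k w \<in> auto H" if "w \<in> carrier W" for w
    using that m k by (auto simp: hom_def carrier_AutoGroup)
  then have auto: "?f w \<in> auto (semidirect N H \<phi>)" if "w \<in> carrier W" for w
    using that compat by (intro semidirect_pair_auto[OF N H \<phi>]) auto
  then show "?f w \<in> carrier (AutoGroup (semidirect N H \<phi>))" if "w \<in> carrier W" for w
    using that by (simp add: carrier_AutoGroup)
  fix w w' assume w: "w \<in> carrier W" "w' \<in> carrier W"
  show "?f (w \<otimes>\<^bsub>W\<^esub> w') = ?f w \<otimes>\<^bsub>AutoGroup (semidirect N H \<phi>)\<^esub> ?f w'"
    unfolding mult_AutoGroup[OF auto[OF w(1)] auto[OF w(2)]]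
    using w autoD(5)[OF mk(1)] autoD(5)[OF mk(2)]
    by (auto simp: hom_mult[OF m] hom_mult[OF k] mult_AutoGroup mk compose_def restrict_def fun_eq_iff)
qed

section \<open>Congruences\<close>

lemma power_nat_add_mod_cong:
  assumes "[x ^ n = 1] (mod m)" "0 \<le> i" "0 \<le> j"
  shows "[x ^ nat ((i + j) mod int n) = x ^ nat i * x ^ nat j] (mod m :: int)"
proof -
  let ?k = "nat i + nat j"
  have "[(x ^ n) ^ (?k div n) * x ^ (?k mod n) = 1 ^ (?k div n) * x ^ (?k mod n)] (mod m)"
    using assms by (intro cong_mult cong_pow cong_refl)
  moreover have "(x ^ n) ^ (?k div n) * x ^ (?k mod n) = x ^ nat i * x ^ nat j"
    by (simp flip: power_mult power_add)
  moreover have "nat ((i + j) mod int n) = ?k mod n"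
    using assms by (simp add: nat_mod_distrib nat_add_distrib)
  ultimately show ?thesis
    by (simp add: cong_sym)
qed

lemma inverse_unique_cong:
  fixes x :: int
  assumes "[x * y = 1] (mod m)" "[x' * y' = 1] (mod m)" "[x = x'] (mod m)"
  shows "[y = y'] (mod m)"
proof -
  have "[y = y * (x' * y')] (mod m)"
    using cong_mult[OF cong_refl assms(2), of y] by (simp add: cong_sym)
  also have "[y * (x' * y') = y * (x * y')] (mod m)"
    using assms(3) by (intro cong_mult cong_refl) (rule cong_sym)
  also have "y * (x * y') = x * y * y'"
    by simp
  also have "[x * y * y' = y'] (mod m)"
    using cong_mult[OF assms(1) cong_refl, of y'] by simp
  finally show ?thesis .
qed

text \<open>The powers of \<open>r\<close> modulo \<open>p\<close> are those of its representative in \<open>{0..<p}\<close>, a natural number.\<close>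

lemma int_ord_divides:
  fixes r :: int and p :: nat
  assumes "p > 0"
  shows "[r ^ k = 1] (mod int p) \<longleftrightarrow> ord (int p) r dvd k"
proof -
  define r' where "r' = nat (r mod int p)"
  have r': "r mod int p = int r'"
    using assms by (simp add: r'_def)
  have pow: "[r ^ d = 1] (mod int p) \<longleftrightarrow> [r' ^ d = 1] (mod p)" for d
  proof -
    have "[r ^ d = int r' ^ d] (mod int p)"
      by (intro cong_pow) (simp add: cong_def flip: r')
    then have "[r ^ d = 1] (mod int p) \<longleftrightarrow> [int r' ^ d = 1] (mod int p)"
      by (metis cong_sym cong_trans)
    also have "\<dots> \<longleftrightarrow> [r' ^ d = 1] (mod p)"
      by (metis cong_int_iff of_nat_1 of_nat_power)
    finally show ?thesis .
  qed
  have "coprime (int p) r \<longleftrightarrow> coprime (int p) (int r')"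
    unfolding r'[symmetric] using assms by simp
  then have "ord (int p) r = ord p r'"
    by (simp add: ord_def pow)
  then show ?thesis
    by (simp only: pow ord_divides)
qed

text \<open>Invertibility of \<open>1 - z\<close> for \<open>z \<noteq> 1\<close>. With \<open>z\<close> an eigenvalue of the action, \<open>x - z * x\<close> is the
  displacement that conjugation by \<open>x\<close> produces on the complement, so every displacement is realised by
  a conjugation, and by \<open>fixed_point_equation_inj\<close> by only one.\<close>

lemma solve_fixed_point_equation:
  assumes "Factorial_Ring.prime (p :: nat)" "\<not> [z = 1] (mod int p)" "v \<in> {0..<int p}"
  obtains x where "x \<in> {0..<int p}" "(x - z * x) mod int p = v"
proof -
  have "\<not> int p dvd 1 - z"
    using assms(2) by (metis cong_iff_dvd_diff cong_sym)
  then have "coprime (1 - z) (int p)"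
    using assms(1) by (metis coprime_commute prime_imp_coprime prime_int_nat_transfer prime_nat_int_transfer)
  then obtain u where u: "[(1 - z) * u = 1] (mod int p)"
    using cong_solve_coprime_int by blast
  let ?x = "(u * v) mod int p"
  have "[(1 - z) * ?x = (1 - z) * u * v] (mod int p)"
    by (simp add: cong_def mod_simps mult.assoc)
  also have "[(1 - z) * u * v = 1 * v] (mod int p)"
    using u by (rule cong_mult) simp
  finally have "(?x - z * ?x) mod int p = v mod int p"
    by (simp add: cong_def left_diff_distrib)
  then show thesis
    using assms by (intro that[of ?x]) (auto simp: prime_gt_0_nat)
qed

lemma fixed_point_equation_inj:
  assumes "Factorial_Ring.prime (p :: nat)" "\<not> [z = 1] (mod int p)" "x \<in> {0..<int p}" "x' \<in> {0..<int p}"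
    and "(x - z * x) mod int p = (x' - z * x') mod int p"
  shows "x = x'"
proof -
  have "int p dvd (x - z * x) - (x' - z * x')"
    using assms(5) by (simp add: mod_eq_dvd_iff)
  also have "(x - z * x) - (x' - z * x') = (1 - z) * (x - x')"
    by (simp add: algebra_simps)
  finally have "int p dvd 1 - z \<or> int p dvd x - x'"
    using assms(1) by (simp add: prime_dvd_mult_iff)
  moreover have "\<not> int p dvd 1 - z"
    using assms(2) by (metis cong_iff_dvd_diff cong_sym)
  ultimately have "x mod int p = x' mod int p"
    by (simp add: mod_eq_dvd_iff)
  then show ?thesis
    using assms(3,4) by simp
qed

section \<open>Monomial matrices modulo an integer\<close>

abbreviation plane :: "nat \<Rightarrow> (int \<times> int) monoid" where
  "plane n \<equiv> integer_mod_group n \<times>\<times> integer_mod_group n"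

lemma group_plane: "group (plane n)"
  by (simp add: DirProd_group)

text \<open>Multiplication by the monomial matrix with entries \<open>x\<close> and \<open>y\<close>: diagonal for \<open>t = 0\<close>, antidiagonal
  otherwise. The first row holds \<open>x\<close> in both cases, so that \<open>x = y = 1\<close>, \<open>t = 1\<close> is the swap of the
  two coordinates.\<close>

definition monomial :: "nat \<Rightarrow> int \<Rightarrow> int \<Rightarrow> int \<Rightarrow> int \<times> int \<Rightarrow> int \<times> int" where
  "monomial n x y t = restrict
     (\<lambda>(j, k). if t = 0 then (x * j mod int n, y * k mod int n) else (x * k mod int n, y * j mod int n))
     (carrier (plane n))"

lemma monomial_apply:
  assumes "n > 0" "0 \<le> j" "j < int n" "0 \<le> k" "k < int n"
  shows "monomial n x y t (j, k) =
    (if t = 0 then (x * j mod int n, y * k mod int n) else (x * k mod int n, y * j mod int n))"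
  using assms by (simp add: monomial_def carrier_integer_mod_group)

lemma monomial_cong:
  assumes "[x = x'] (mod int n)" "[y = y'] (mod int n)"
  shows "monomial n x y t = monomial n x' y' t"
proof -
  have "x * j mod int n = x' * j mod int n" "y * j mod int n = y' * j mod int n" for j
    using assms by (metis cong_def mod_mult_left_eq)+
  then show ?thesis
    unfolding monomial_def by (intro arg_cong2[where f = restrict] ext refl) (auto split: prod.split)
qed

lemma monomial_closed: "n > 0 \<Longrightarrow> v \<in> carrier (plane n) \<Longrightarrow> monomial n x y t v \<in> carrier (plane n)"
  by (cases v) (auto simp: carrier_integer_mod_group monomial_apply)

text \<open>Moving a swap past a diagonal matrix exchanges its entries, as in the semidirect product of the
  group of diagonal matrices and \<open>\<int>\<^sub>2\<close> acting by the swap.\<close>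

lemma monomial_monomial:
  assumes "n > 0" "v \<in> carrier (plane n)" "t \<in> {0, 1}" "t' \<in> {0, 1}"
  shows "monomial n x y t (monomial n x' y' t' v) =
    monomial n (x * (if t = 0 then x' else y')) (y * (if t = 0 then y' else x')) ((t + t') mod 2) v"
  using assms by (cases v) (auto simp: carrier_integer_mod_group monomial_apply mod_simps mult.assoc)

lemma monomial_one: "n > 0 \<Longrightarrow> v \<in> carrier (plane n) \<Longrightarrow> monomial n 1 1 0 v = v"
  by (cases v) (auto simp: carrier_integer_mod_group monomial_apply)

lemma monomial_hom: "n > 0 \<Longrightarrow> monomial n x y t \<in> hom (plane n) (plane n)"
  by (rule homI) (auto simp: carrier_integer_mod_group monomial_apply mod_simps distrib_left)

lemma monomial_auto:
  assumes n: "n > 0" and "coprime x (int n)" "coprime y (int n)" and t: "t \<in> {0, 1}"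
  shows "monomial n x y t \<in> auto (plane n)"
proof (rule autoI)
  obtain x' y' where inv: "[x * x' = 1] (mod int n)" "[y * y' = 1] (mod int n)"
    using assms by (meson cong_solve_coprime_int)
  then have inv': "[x' * x = 1] (mod int n)" "[y' * y = 1] (mod int n)"
    by (simp_all add: mult.commute)
  \<comment> \<open>The inverse of an antidiagonal matrix has the inverse entries in exchanged positions.\<close>
  let ?m = "monomial n (if t = 0 then x' else y') (if t = 0 then y' else x') t"
  have "?m (monomial n x y t v) = v" "monomial n x y t (?m v) = v" if "v \<in> carrier (plane n)" for v
    using that t monomial_cong[OF inv, of 0] monomial_cong[OF inv', of 0]
      monomial_cong[OF inv(2,1), of 0] monomial_cong[OF inv'(2,1), of 0]
    by (auto simp: monomial_monomial[OF n] monomial_one[OF n] simp del: DirProd_def)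
  then show "bij_betw (monomial n x y t) (carrier (plane n)) (carrier (plane n))"
    using monomial_closed[OF n] by (intro bij_betw_byWitness[where f' = ?m]) blast+
  show "monomial n x y t \<in> extensional (carrier (plane n))"
    by (simp add: monomial_def)
qed (rule monomial_hom[OF n])

lemma integer_mod_group_2: "carrier (integer_mod_group 2) = {0, 1}"
  by (auto simp: carrier_integer_mod_group)

definition swap_action :: "nat \<Rightarrow> int \<Rightarrow> int \<times> int \<Rightarrow> int \<times> int" where
  "swap_action m = monomial m 1 1"

abbreviation monomial_group :: "nat \<Rightarrow> ((int \<times> int) \<times> int) monoid" where
  "monomial_group m \<equiv> semidirect (plane m) (integer_mod_group 2) (swap_action m)"

lemma swap_action_hom:
  assumes "m > 0"
  shows "swap_action m \<in> hom (integer_mod_group 2) (AutoGroup (plane m))"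
proof (rule hom_AutoGroupI)
  fix t t' v assume "t \<in> carrier (integer_mod_group 2)" "t' \<in> carrier (integer_mod_group 2)"
    "v \<in> carrier (plane m)"
  then show "swap_action m (t \<otimes>\<^bsub>integer_mod_group 2\<^esub> t') v = swap_action m t (swap_action m t' v)"
    by (simp add: swap_action_def integer_mod_group_2 monomial_monomial[OF assms] del: carrier_DirProd)
qed (auto simp: swap_action_def integer_mod_group_2 intro!: monomial_auto assms)

lemma group_monomial_group: "m > 0 \<Longrightarrow> group (monomial_group m)"
  by (intro group_semidirect group_plane swap_action_hom) simp_all

section \<open>The concrete model of the group\<close>

locale diagonal_action =
  fixes p n :: nat and r s :: int
  assumes prime_p: "Factorial_Ring.prime p" and n_gt_2: "2 < n" and n_dvd: "n dvd p - 1"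
    and rs: "[r * s = 1] (mod int p)"
    and r_order: "\<And>k. [r ^ k = 1] (mod int p) \<longleftrightarrow> n dvd k"
begin

lemma p_gt_1: "p > 1" and n_pos: "n > 0" and p_pos: "p > 0" "p - 1 > 0"
  using prime_gt_1_nat[OF prime_p] n_gt_2 by auto

lemma rs_power: "[r ^ k * s ^ k = 1] (mod int p)"
  using cong_pow[OF rs, of k] by (simp add: power_mult_distrib)

lemma s_order: "[s ^ k = 1] (mod int p) \<longleftrightarrow> n dvd k"
proof -
  have "[s ^ k = 1] (mod int p) \<longleftrightarrow> [r ^ k = 1] (mod int p)"
    using inverse_unique_cong[of "r ^ k" "s ^ k" "int p" 1 1]
      inverse_unique_cong[of "s ^ k" "r ^ k" "int p" 1 1] rs_power[of k]
    by (auto simp: mult.commute)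
  then show ?thesis by (simp add: r_order)
qed

lemma neq_1: "\<not> [r = 1] (mod int p)" "\<not> [s = 1] (mod int p)"
  using r_order[of 1] s_order[of 1] n_gt_2 by simp_all

text \<open>The two eigenvalues differ because \<open>r = s = r\<^sup>-\<^sup>1\<close> would force order at most two.\<close>

lemma r_neq_s: "\<not> [r = s] (mod int p)"
proof
  assume "[r = s] (mod int p)"
  then have "[r * r = r * s] (mod int p)"
    by (intro cong_mult cong_refl)
  then have "[r ^ 2 = 1] (mod int p)"
    using rs cong_trans by (auto simp: power2_eq_square)
  then show False
    using r_order[of 2] n_gt_2 by (auto dest: dvd_imp_le)
qed

lemma coprime_rs: "coprime r (int p)" "coprime s (int p)"
  using rs by (metis coprime_iff_invertible_int mult.commute)+

text \<open>The action of the generator of \<open>\<int>\<^sub>n\<close> on \<open>\<int>\<^sub>p \<times> \<int>\<^sub>p\<close> is the diagonal matrix with entries \<open>r\<close> and \<open>s\<close>. As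
  semidirect products use left actions while the presentation gives \<open>a\<^sup>-\<^sup>1 b a = b\<^sup>r\<close>, this generator
  corresponds to \<open>a\<^sup>-\<^sup>1\<close>.\<close>

definition \<theta> :: "int \<Rightarrow> int \<times> int \<Rightarrow> int \<times> int" where
  "\<theta> i = monomial p (r ^ nat i) (s ^ nat i) 0"

abbreviation K :: "((int \<times> int) \<times> int) monoid" where
  "K \<equiv> semidirect (plane p) (integer_mod_group n) \<theta>"

lemma theta_hom: "\<theta> \<in> hom (integer_mod_group n) (AutoGroup (plane p))"
proof (rule hom_AutoGroupI)
  fix i j v assume ij: "i \<in> carrier (integer_mod_group n)" "j \<in> carrier (integer_mod_group n)"
    and v: "v \<in> carrier (plane p)"
  have "[r ^ nat ((i + j) mod int n) = r ^ nat i * r ^ nat j] (mod int p)"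
    "[s ^ nat ((i + j) mod int n) = s ^ nat i * s ^ nat j] (mod int p)"
    using ij n_pos by (auto intro!: power_nat_add_mod_cong simp: r_order s_order carrier_integer_mod_group)
  from monomial_cong[OF this, of 0] show "\<theta> (i \<otimes>\<^bsub>integer_mod_group n\<^esub> j) v = \<theta> i (\<theta> j v)"
    using monomial_monomial[OF p_pos(1) v] by (simp add: \<theta>_def)
next
  show "\<theta> i \<in> auto (plane p)" for i
    using p_pos coprime_rs by (auto simp: \<theta>_def intro!: monomial_auto)
qed simp

lemma group_K: "group K"
  by (intro group_semidirect theta_hom group_plane) simp

lemma theta_0: "v \<in> carrier (plane p) \<Longrightarrow> \<theta> 0 v = v"
  using monomial_one[OF p_pos(1)] by (simp add: \<theta>_def)

interpretation K: group K by (rule group_K)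

abbreviation "gen_a \<equiv> ((0, 0), 1) :: (int \<times> int) \<times> int"

abbreviation "gen_b \<equiv> ((1, 0), 0) :: (int \<times> int) \<times> int"

abbreviation "gen_c \<equiv> ((0, 1), 0) :: (int \<times> int) \<times> int"

lemma carrier_Zp: "carrier (integer_mod_group p) = {0..<int p}"
  and carrier_Zn: "carrier (integer_mod_group n) = {0..<int n}"
  using p_pos n_pos by (simp_all add: carrier_integer_mod_group)

lemma theta_apply:
  "j \<in> {0..<int p} \<Longrightarrow> k \<in> {0..<int p} \<Longrightarrow> \<theta> i (j, k) = (r ^ nat i * j mod int p, s ^ nat i * k mod int p)"
  using p_pos by (simp add: \<theta>_def monomial_apply)

lemma gens_closed: "gen_a \<in> carrier K" "gen_b \<in> carrier K" "gen_c \<in> carrier K"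
  using p_gt_1 n_gt_2 by (simp_all add: carrier_Zp carrier_Zn)

lemma pow_inl:
  assumes "x \<in> {0..<int p}" "y \<in> {0..<int p}"
  shows "((x, y), 0) [^]\<^bsub>K\<^esub> (m :: nat) = ((int m * x mod int p, int m * y mod int p), 0)"
  using assms by (induction m) (auto simp: theta_apply mod_simps distrib_right add.commute)

lemma int_pow_inl:
  assumes "x \<in> {0..<int p}" "y \<in> {0..<int p}"
  shows "((x, y), 0) [^]\<^bsub>K\<^esub> (m :: int) = ((m * x mod int p, m * y mod int p), 0)"
proof -
  have z: "((x, y), 0) \<in> carrier K"
    using assms n_pos by (simp add: carrier_Zp)
  have "((x, y), 0) [^]\<^bsub>K\<^esub> m = ((x, y), 0) [^]\<^bsub>K\<^esub> int (nat (m mod int p))"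
    using K.int_pow_mod[OF z, of p m] assms p_pos by (simp add: pow_inl)
  also have "\<dots> = ((m * x mod int p, m * y mod int p), 0)"
    unfolding int_pow_int pow_inl[OF assms] using p_pos by (simp add: mod_simps)
  finally show ?thesis .
qed

lemma pow_gen_a: "gen_a [^]\<^bsub>K\<^esub> (m :: nat) = ((0, 0), int m mod int n)"
  using p_pos by (induction m) (auto simp: theta_apply mod_simps add.commute)

lemma hom_K_eq:
  assumes A: "group A" and F: "F \<in> hom K A" "F' \<in> hom K A"
    and gens: "F gen_a = F' gen_a" "F gen_b = F' gen_b" "F gen_c = F' gen_c"
    and z: "z \<in> carrier K"
  shows "F z = F' z"
proof -
  interpret F: group_hom K A F
    using A F(1) by (simp add: group_hom_def group_hom_axioms_def group_K)
  interpret F': group_hom K A F'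
    using A F(2) by (simp add: group_hom_def group_hom_axioms_def group_K)
  obtain j k i where eq: "z = ((j, k), i)"
    by (metis prod.exhaust)
  have jki: "j \<in> {0..<int p}" "k \<in> {0..<int p}" "i \<in> {0..<int n}"
    using z by (auto simp: eq carrier_Zp carrier_Zn)
  then have "z = gen_b [^]\<^bsub>K\<^esub> j \<otimes>\<^bsub>K\<^esub> (gen_c [^]\<^bsub>K\<^esub> k \<otimes>\<^bsub>K\<^esub> gen_a [^]\<^bsub>K\<^esub> nat i)"
    using p_gt_1 by (simp add: int_pow_inl pow_gen_a theta_apply eq)
  then show ?thesis
    using gens_closed by (simp add: F.hom_nat_pow F'.hom_nat_pow F.hom_int_pow F'.hom_int_pow gens del: carrier_semidirect mult_semidirect)
qed

lemma relations_K:
  "gen_a \<otimes>\<^bsub>K\<^esub> gen_b = gen_b [^]\<^bsub>K\<^esub> r \<otimes>\<^bsub>K\<^esub> gen_a"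
  "gen_a \<otimes>\<^bsub>K\<^esub> gen_c = gen_c [^]\<^bsub>K\<^esub> s \<otimes>\<^bsub>K\<^esub> gen_a"
  using p_gt_1 n_gt_2 by (simp_all add: int_pow_inl theta_apply mod_simps)

text \<open>Normal forms \<open>b\<^sup>j c\<^sup>k a\<^sup>i\<close> multiply in \<open>G\<close> as in \<open>K\<close>, so they define a homomorphism. Here \<open>a\<close> is the
  element acting from the left.\<close>

lemma hom_from_K:
  assumes G: "group G" and carrier: "a \<in> carrier G" "b \<in> carrier G" "c \<in> carrier G"
    and orders: "a [^]\<^bsub>G\<^esub> n = \<one>\<^bsub>G\<^esub>" "b [^]\<^bsub>G\<^esub> p = \<one>\<^bsub>G\<^esub>" "c [^]\<^bsub>G\<^esub> p = \<one>\<^bsub>G\<^esub>"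
    and bc: "b \<otimes>\<^bsub>G\<^esub> c = c \<otimes>\<^bsub>G\<^esub> b"
    and ab: "a \<otimes>\<^bsub>G\<^esub> b = b [^]\<^bsub>G\<^esub> r \<otimes>\<^bsub>G\<^esub> a"
    and ac: "a \<otimes>\<^bsub>G\<^esub> c = c [^]\<^bsub>G\<^esub> s \<otimes>\<^bsub>G\<^esub> a"
  obtains \<Phi> where "\<Phi> \<in> hom K G" "\<Phi> gen_a = a" "\<Phi> gen_b = b" "\<Phi> gen_c = c"
proof -
  interpret G: group G by fact
  define \<alpha> where "\<alpha> = (\<lambda>(j :: int, k :: int). b [^]\<^bsub>G\<^esub> j \<otimes>\<^bsub>G\<^esub> c [^]\<^bsub>G\<^esub> k)"
  have comm: "c [^]\<^bsub>G\<^esub> k \<otimes>\<^bsub>G\<^esub> b [^]\<^bsub>G\<^esub> j = b [^]\<^bsub>G\<^esub> j \<otimes>\<^bsub>G\<^esub> c [^]\<^bsub>G\<^esub> k" for j k :: int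
    using G.int_pow_conjugate[of b c c k] G.int_pow_conjugate[of "c [^]\<^bsub>G\<^esub> k" b b j] carrier bc by simp
  have shift: "b [^]\<^bsub>G\<^esub> j \<otimes>\<^bsub>G\<^esub> b [^]\<^bsub>G\<^esub> j' \<otimes>\<^bsub>G\<^esub> (c [^]\<^bsub>G\<^esub> k \<otimes>\<^bsub>G\<^esub> c [^]\<^bsub>G\<^esub> k') =
    b [^]\<^bsub>G\<^esub> j \<otimes>\<^bsub>G\<^esub> c [^]\<^bsub>G\<^esub> k \<otimes>\<^bsub>G\<^esub> (b [^]\<^bsub>G\<^esub> j' \<otimes>\<^bsub>G\<^esub> c [^]\<^bsub>G\<^esub> k')" for j j' k k' :: int
  proof -
    have "b [^]\<^bsub>G\<^esub> j \<otimes>\<^bsub>G\<^esub> b [^]\<^bsub>G\<^esub> j' \<otimes>\<^bsub>G\<^esub> (c [^]\<^bsub>G\<^esub> k \<otimes>\<^bsub>G\<^esub> c [^]\<^bsub>G\<^esub> k') =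
      b [^]\<^bsub>G\<^esub> j \<otimes>\<^bsub>G\<^esub> (b [^]\<^bsub>G\<^esub> j' \<otimes>\<^bsub>G\<^esub> c [^]\<^bsub>G\<^esub> k) \<otimes>\<^bsub>G\<^esub> c [^]\<^bsub>G\<^esub> k'"
      using carrier by (simp add: G.m_assoc)
    also have "\<dots> = b [^]\<^bsub>G\<^esub> j \<otimes>\<^bsub>G\<^esub> (c [^]\<^bsub>G\<^esub> k \<otimes>\<^bsub>G\<^esub> b [^]\<^bsub>G\<^esub> j') \<otimes>\<^bsub>G\<^esub> c [^]\<^bsub>G\<^esub> k'"
      by (simp only: comm)
    finally show ?thesis
      using carrier by (simp add: G.m_assoc)
  qed
  have \<alpha>_hom: "\<alpha> \<in> hom (plane p) G"
    using carrier by (intro homI)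
      (auto simp: \<alpha>_def G.int_pow_mod[OF carrier(2) orders(2)] G.int_pow_mod[OF carrier(3) orders(3)]
        G.int_pow_mult shift)
  have \<beta>_hom: "(\<lambda>i :: int. a [^]\<^bsub>G\<^esub> i) \<in> hom (integer_mod_group n) G"
    using carrier orders by (intro G.hom_integer_mod_group)
  \<comment> \<open>Moving \<open>a\<^sup>m\<close> to the right multiplies exponents by the \<open>m\<close>-th power of the eigenvalue.\<close>
  have move: "a [^]\<^bsub>G\<^esub> m \<otimes>\<^bsub>G\<^esub> y [^]\<^bsub>G\<^esub> j = y [^]\<^bsub>G\<^esub> (x ^ m * j) \<otimes>\<^bsub>G\<^esub> a [^]\<^bsub>G\<^esub> m"
    if y: "y \<in> carrier G" "a \<otimes>\<^bsub>G\<^esub> y = y [^]\<^bsub>G\<^esub> x \<otimes>\<^bsub>G\<^esub> a" for y and x j :: int and m :: nat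
  proof (induction m arbitrary: j)
    case 0
    then show ?case using y by simp
  next
    case (Suc m)
    have "a \<otimes>\<^bsub>G\<^esub> y [^]\<^bsub>G\<^esub> j = (y [^]\<^bsub>G\<^esub> x) [^]\<^bsub>G\<^esub> j \<otimes>\<^bsub>G\<^esub> a"
      using y carrier by (intro G.int_pow_conjugate) auto
    then have *: "a \<otimes>\<^bsub>G\<^esub> y [^]\<^bsub>G\<^esub> j = y [^]\<^bsub>G\<^esub> (x * j) \<otimes>\<^bsub>G\<^esub> a"
      using y by (simp add: G.int_pow_pow)
    have "a [^]\<^bsub>G\<^esub> Suc m \<otimes>\<^bsub>G\<^esub> y [^]\<^bsub>G\<^esub> j = a [^]\<^bsub>G\<^esub> m \<otimes>\<^bsub>G\<^esub> y [^]\<^bsub>G\<^esub> (x * j) \<otimes>\<^bsub>G\<^esub> a"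
      using y carrier by (simp add: G.m_assoc *)
    also have "\<dots> = y [^]\<^bsub>G\<^esub> (x ^ m * (x * j)) \<otimes>\<^bsub>G\<^esub> a [^]\<^bsub>G\<^esub> m \<otimes>\<^bsub>G\<^esub> a"
      by (simp only: Suc)
    finally show ?case
      using y carrier by (simp add: G.m_assoc ac_simps)
  qed
  have compat: "a [^]\<^bsub>G\<^esub> i \<otimes>\<^bsub>G\<^esub> \<alpha> v = \<alpha> (\<theta> i v) \<otimes>\<^bsub>G\<^esub> a [^]\<^bsub>G\<^esub> i"
    if v: "v \<in> carrier (plane p)" and i: "i \<in> carrier (integer_mod_group n)" for v and i :: int
  proof -
    obtain j k where jk: "v = (j, k)" "j \<in> {0..<int p}" "k \<in> {0..<int p}"
      using v by (auto simp: carrier_Zp)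
    define m where "m = nat i"
    have m: "i = int m"
      using i by (simp add: m_def carrier_Zn)
    have "a [^]\<^bsub>G\<^esub> m \<otimes>\<^bsub>G\<^esub> \<alpha> v = a [^]\<^bsub>G\<^esub> m \<otimes>\<^bsub>G\<^esub> b [^]\<^bsub>G\<^esub> j \<otimes>\<^bsub>G\<^esub> c [^]\<^bsub>G\<^esub> k"
      using carrier by (simp add: \<alpha>_def jk G.m_assoc)
    also have "\<dots> = b [^]\<^bsub>G\<^esub> (r ^ m * j) \<otimes>\<^bsub>G\<^esub> (a [^]\<^bsub>G\<^esub> m \<otimes>\<^bsub>G\<^esub> c [^]\<^bsub>G\<^esub> k)"
      using carrier move[OF carrier(2) ab] by (simp add: G.m_assoc)
    also have "\<dots> = b [^]\<^bsub>G\<^esub> (r ^ m * j) \<otimes>\<^bsub>G\<^esub> c [^]\<^bsub>G\<^esub> (s ^ m * k) \<otimes>\<^bsub>G\<^esub> a [^]\<^bsub>G\<^esub> m"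
      using carrier move[OF carrier(3) ac] by (simp add: G.m_assoc)
    also have "\<dots> = \<alpha> (\<theta> i v) \<otimes>\<^bsub>G\<^esub> a [^]\<^bsub>G\<^esub> m"
      using jk by (simp add: \<alpha>_def theta_apply m G.int_pow_mod[OF carrier(2) orders(2)]
          G.int_pow_mod[OF carrier(3) orders(3)])
    finally show ?thesis
      by (simp add: m int_pow_int)
  qed
  show thesis
  proof
    show "(\<lambda>(v, i). \<alpha> v \<otimes>\<^bsub>G\<^esub> a [^]\<^bsub>G\<^esub> i) \<in> hom K G"
      using monomial_closed p_pos
      by (intro semidirect_hom G \<alpha>_hom \<beta>_hom group_plane compat) (auto simp: \<theta>_def simp del: carrier_DirProd)
  qed (use carrier in \<open>simp_all add: \<alpha>_def\<close>)
qed

text \<open>Both groups map to each other by their universal properties, with \<open>a\<close> corresponding to the inverse of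
  \<open>gen_a\<close>; the composites fix the generators and are therefore identities.\<close>

lemma G_group_iso_K:
  assumes n: "n = q\<^sup>2"
  shows "group (G_group p q r s)" "G_group p q r s \<cong> K"
proof -
  interpret F: group "free_group :: gen word set monoid"
    by (rule group_free_group)
  let ?F = "free_group :: gen word set monoid"
  define E where "E =
    {(free_gen GenA [^]\<^bsub>?F\<^esub> (q ^ 2), \<one>\<^bsub>?F\<^esub>),
     (free_gen GenB [^]\<^bsub>?F\<^esub> p, \<one>\<^bsub>?F\<^esub>),
     (free_gen GenC [^]\<^bsub>?F\<^esub> p, \<one>\<^bsub>?F\<^esub>),
     (commutator ?F (free_gen GenB) (free_gen GenC), \<one>\<^bsub>?F\<^esub>),
     (inv\<^bsub>?F\<^esub> (free_gen GenA) \<otimes>\<^bsub>?F\<^esub> free_gen GenB \<otimes>\<^bsub>?F\<^esub> free_gen GenA, free_gen GenB [^]\<^bsub>?F\<^esub> r),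
     (inv\<^bsub>?F\<^esub> (free_gen GenA) \<otimes>\<^bsub>?F\<^esub> free_gen GenC \<otimes>\<^bsub>?F\<^esub> free_gen GenA, free_gen GenC [^]\<^bsub>?F\<^esub> s)}"
  define G where "G = presented_group E"
  have G_eq: "G_group p q r s = G"
    by (simp add: G_group_def G_def E_def Let_def)
  have E: "u \<in> carrier ?F \<and> v \<in> carrier ?F" if "(u, v) \<in> E" for u v
    using that by (auto simp: E_def commutator_def free_gen_closed)
  have "group G"
    unfolding G_def by (rule group_presented_group[OF E])
  then interpret G: group G .
  define \<pi> where "\<pi> = presented_class E"
  interpret \<pi>: group_hom ?F G \<pi>
    using hom_presented_class[OF E] \<open>group G\<close>
    by (simp add: group_hom_def group_hom_axioms_def group_free_group G_def \<pi>_def)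
  define A B C where ABC: "A = \<pi> (free_gen GenA)" "B = \<pi> (free_gen GenB)" "C = \<pi> (free_gen GenC)"
  have carrier: "A \<in> carrier G" "B \<in> carrier G" "C \<in> carrier G"
    by (simp_all add: ABC free_gen_closed)
  have rel: "\<pi> u = \<pi> v" if "(u, v) \<in> E" for u v
    unfolding \<pi>_def by (rule presented_class_relation[OF E that])
  have orders: "A [^]\<^bsub>G\<^esub> n = \<one>\<^bsub>G\<^esub>" "B [^]\<^bsub>G\<^esub> p = \<one>\<^bsub>G\<^esub>" "C [^]\<^bsub>G\<^esub> p = \<one>\<^bsub>G\<^esub>"
    using rel[of "free_gen GenA [^]\<^bsub>?F\<^esub> (q ^ 2)" "\<one>\<^bsub>?F\<^esub>"] rel[of "free_gen GenB [^]\<^bsub>?F\<^esub> p" "\<one>\<^bsub>?F\<^esub>"]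
      rel[of "free_gen GenC [^]\<^bsub>?F\<^esub> p" "\<one>\<^bsub>?F\<^esub>"]
    by (simp_all add: E_def \<pi>.hom_nat_pow free_gen_closed n ABC)
  have "commutator G B C = \<one>\<^bsub>G\<^esub>"
    using rel[of "commutator ?F (free_gen GenB) (free_gen GenC)" "\<one>\<^bsub>?F\<^esub>"]
    by (simp add: E_def commutator_def free_gen_closed ABC)
  then have BC: "B \<otimes>\<^bsub>G\<^esub> C = C \<otimes>\<^bsub>G\<^esub> B"
    using carrier by (simp add: G.commutator_eq_one_iff)
  have "inv\<^bsub>G\<^esub> A \<otimes>\<^bsub>G\<^esub> B \<otimes>\<^bsub>G\<^esub> A = B [^]\<^bsub>G\<^esub> r"
    using rel[of "inv\<^bsub>?F\<^esub> (free_gen GenA) \<otimes>\<^bsub>?F\<^esub> free_gen GenB \<otimes>\<^bsub>?F\<^esub> free_gen GenA" "free_gen GenB [^]\<^bsub>?F\<^esub> r"]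
    by (simp add: E_def \<pi>.hom_int_pow free_gen_closed ABC)
  then have AB: "inv\<^bsub>G\<^esub> A \<otimes>\<^bsub>G\<^esub> B = B [^]\<^bsub>G\<^esub> r \<otimes>\<^bsub>G\<^esub> inv\<^bsub>G\<^esub> A"
    using carrier by (metis G.inv_closed G.inv_solve_right G.m_closed G.int_pow_closed)
  have "inv\<^bsub>G\<^esub> A \<otimes>\<^bsub>G\<^esub> C \<otimes>\<^bsub>G\<^esub> A = C [^]\<^bsub>G\<^esub> s"
    using rel[of "inv\<^bsub>?F\<^esub> (free_gen GenA) \<otimes>\<^bsub>?F\<^esub> free_gen GenC \<otimes>\<^bsub>?F\<^esub> free_gen GenA" "free_gen GenC [^]\<^bsub>?F\<^esub> s"]
    by (simp add: E_def \<pi>.hom_int_pow free_gen_closed ABC)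
  then have AC: "inv\<^bsub>G\<^esub> A \<otimes>\<^bsub>G\<^esub> C = C [^]\<^bsub>G\<^esub> s \<otimes>\<^bsub>G\<^esub> inv\<^bsub>G\<^esub> A"
    using carrier by (metis G.inv_closed G.inv_solve_right G.m_closed G.int_pow_closed)
  have "inv\<^bsub>G\<^esub> A [^]\<^bsub>G\<^esub> n = \<one>\<^bsub>G\<^esub>"
    using carrier orders by (simp add: G.nat_pow_inv)
  then obtain \<Phi> where \<Phi>: "\<Phi> \<in> hom K G" "\<Phi> gen_a = inv\<^bsub>G\<^esub> A" "\<Phi> gen_b = B" "\<Phi> gen_c = C"
    using hom_from_K[OF \<open>group G\<close> _ carrier(2,3) _ orders(2,3) BC AB AC] carrier by auto
  define f where "f x = (case x of GenA \<Rightarrow> inv\<^bsub>K\<^esub> gen_a | GenB \<Rightarrow> gen_b | GenC \<Rightarrow> gen_c)" for x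
  have f: "f x \<in> carrier K" for x
    using gens_closed by (cases x) (auto simp: f_def simp del: carrier_semidirect)
  obtain h where h: "h \<in> hom ?F K" "\<And>x. h (free_gen x) = f x"
    using free_group_universal[OF group_K, of f] f by blast
  interpret h: group_hom ?F K h
    using h by (simp add: group_hom_def group_hom_axioms_def group_free_group group_K)
  have "gen_a [^]\<^bsub>K\<^esub> n = \<one>\<^bsub>K\<^esub>" "gen_b [^]\<^bsub>K\<^esub> p = \<one>\<^bsub>K\<^esub>" "gen_c [^]\<^bsub>K\<^esub> p = \<one>\<^bsub>K\<^esub>"
    using p_gt_1 by (simp_all add: pow_inl pow_gen_a)
  moreover have "commutator K gen_b gen_c = \<one>\<^bsub>K\<^esub>"
    using gens_closed p_gt_1 by (subst K.commutator_eq_one_iff) (auto simp: theta_0 carrier_Zp)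
  moreover have "gen_a \<otimes>\<^bsub>K\<^esub> gen_b \<otimes>\<^bsub>K\<^esub> inv\<^bsub>K\<^esub> gen_a = gen_b [^]\<^bsub>K\<^esub> r"
    "gen_a \<otimes>\<^bsub>K\<^esub> gen_c \<otimes>\<^bsub>K\<^esub> inv\<^bsub>K\<^esub> gen_a = gen_c [^]\<^bsub>K\<^esub> s"
    unfolding relations_K using gens_closed
    by (simp_all add: K.m_assoc del: carrier_semidirect mult_semidirect one_semidirect)
  ultimately have "h u = h v" if "(u, v) \<in> E" for u v
    using that gens_closed
    by (auto simp: E_def commutator_def free_gen_closed h.hom_nat_pow h.hom_int_pow h(2) f_def K.nat_pow_inv
        simp flip: n simp del: carrier_semidirect mult_semidirect one_semidirect)
  then obtain k where k: "k \<in> hom G K" "\<And>u. u \<in> carrier ?F \<Longrightarrow> k (\<pi> u) = h u"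
    using presented_group_universal[OF E group_K h(1)] unfolding G_def \<pi>_def by metis
  have kgens: "k A = inv\<^bsub>K\<^esub> gen_a" "k B = gen_b" "k C = gen_c"
    by (simp_all add: ABC k(2) free_gen_closed h(2) f_def)
  interpret k: group_hom G K k
    using k(1) \<open>group G\<close> by (simp add: group_hom_def group_hom_axioms_def group_K)
  interpret \<Phi>: group_hom K G \<Phi>
    using \<Phi>(1) \<open>group G\<close> by (simp add: group_hom_def group_hom_axioms_def group_K)
  have "k (\<Phi> z) = z" if "z \<in> carrier K" for z
  proof -
    have "(\<lambda>x. x) \<in> hom K K"
      by (rule iso_imp_homomorphism[OF iso_set_refl])
    note eq = hom_K_eq[OF group_K hom_compose[OF \<Phi>(1) k(1)] this _ _ _ that]
    have "k (inv\<^bsub>G\<^esub> A) = gen_a"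
      unfolding k.hom_inv[OF carrier(1)] kgens using gens_closed(1) by (rule K.inv_inv)
    then show ?thesis
      using eq by (simp add: \<Phi> kgens)
  qed
  moreover have "\<Phi> (k x) = x" if "x \<in> carrier G" for x
  proof -
    have id: "(\<lambda>x. x) \<in> hom G G"
      by (rule iso_imp_homomorphism[OF iso_set_refl])
    have "\<Phi> (inv\<^bsub>K\<^esub> gen_a) = A"
      unfolding \<Phi>.hom_inv[OF gens_closed(1)] \<Phi>(2) using carrier(1) by (rule G.inv_inv)
    then have gens: "(\<Phi> \<circ> k) (\<pi> (free_gen y)) = \<pi> (free_gen y)" for y
      by (cases y) (simp_all add: kgens \<Phi> flip: ABC)
    have "(\<Phi> \<circ> k) x = x"
      by (rule hom_presented_group_eq[where k' = "\<lambda>x. x", OF E \<open>group G\<close>[unfolded G_def] hom_compose[OF k(1) \<Phi>(1), unfolded G_def]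
            id[unfolded G_def] gens[unfolded \<pi>_def] that[unfolded G_def]])
    then show ?thesis by simp
  qed
  ultimately have "k \<in> iso G K"
    using k(1) by (intro isoI bij_betw_byWitness[where f' = \<Phi>]) (auto simp del: carrier_semidirect)
  then show "group (G_group p q r s)" "G_group p q r s \<cong> K"
    unfolding G_eq using \<open>group G\<close> by (auto intro: is_isoI)
qed

section \<open>The shape of an automorphism\<close>

lemma coprime_p_n: "coprime p n"
proof (rule coprimeI)
  fix d assume "d dvd p" "d dvd n"
  then have "d dvd p" "d dvd p - 1"
    using n_dvd dvd_trans by blast+
  then have "d dvd p - (p - 1)"
    using dvd_diff_nat by blast
  then show "is_unit d"
    using p_gt_1 by simp
qed

text \<open>As \<open>p\<close> and \<open>n\<close> are coprime, \<open>\<int>\<^sub>p \<times> \<int>\<^sub>p\<close> contains every element whose \<open>p\<close>-th power is trivial, so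
  automorphisms map it to itself.\<close>

lemma torsion_K:
  assumes "z \<in> carrier K" "z [^]\<^bsub>K\<^esub> p = \<one>\<^bsub>K\<^esub>"
  shows "snd z = 0"
proof -
  have "snd (z [^]\<^bsub>K\<^esub> p) = snd z [^]\<^bsub>integer_mod_group n\<^esub> p"
    using semidirect_snd_hom assms(1) group_K by (rule hom_nat_pow) simp
  then have "int p * snd z mod int n = 0"
    using assms(2) by simp
  then have "int n dvd int p * snd z"
    by (simp add: dvd_eq_mod_eq_0)
  then have "int n dvd snd z"
    using coprime_p_n by (simp add: coprime_dvd_mult_right_iff coprime_commute)
  then show ?thesis
    using assms(1) by (auto simp: carrier_Zp carrier_Zn dest: zdvd_imp_le)
qed

text \<open>In the first components of the two sides \<open>(v, w)\<close> cancels, and what remains says that \<open>(x, y)\<close> is an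
  eigenvector for \<open>m\<close> of the diagonal matrix with entries \<open>r\<^sup>k\<close> and \<open>s\<^sup>k\<close>.\<close>

lemma eigen_relation:
  assumes "x \<in> {0..<int p}" "y \<in> {0..<int p}" "v \<in> {0..<int p}" "w \<in> {0..<int p}"
    and rel: "((v, w), k) \<otimes>\<^bsub>K\<^esub> ((x, y), 0) = ((x, y), 0) [^]\<^bsub>K\<^esub> m \<otimes>\<^bsub>K\<^esub> ((v, w), k)"
  shows "int p dvd (r ^ nat k - m) * x" "int p dvd (s ^ nat k - m) * y"
proof -
  have *: "int p dvd (c - m) * z" if "(u + c * z) mod int p = (m * z + u) mod int p" for c u z
    using that by (simp add: mod_eq_dvd_iff algebra_simps)
  show "int p dvd (r ^ nat k - m) * x" "int p dvd (s ^ nat k - m) * y"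
    using rel assms p_pos
    by (auto simp: int_pow_inl theta_apply mod_simps intro!: *)
qed

lemma power_eq_r:
  assumes "k \<in> {0..<int n}" "[r ^ nat k = r] (mod int p)"
  shows "k = 1"
proof -
  have "nat k \<noteq> 0"
    using assms(2) neq_1(1) cong_sym[of 1 r] by fastforce
  then obtain m where m: "nat k = Suc m"
    by (cases "nat k") auto
  have "[r * r ^ m = r * 1] (mod int p)"
    using assms(2) by (simp add: m)
  then have "[r ^ m = 1] (mod int p)"
    using coprime_rs cong_mult_lcancel by blast
  then have "n dvd m"
    by (simp add: r_order)
  then have "m = 0"
    using assms(1) m by (auto dest: dvd_imp_le)
  then show ?thesis
    using m by simp
qed

lemma power_eq_s:
  assumes "k \<in> {0..<int n}" "[r ^ nat k = s] (mod int p)"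
  shows "k = int n - 1"
proof -
  have "[r * r ^ nat k = r * s] (mod int p)"
    using assms(2) by (intro cong_mult cong_refl)
  then have "[r ^ Suc (nat k) = 1] (mod int p)"
    using rs cong_trans by auto
  then have "n dvd Suc (nat k)"
    using r_order by blast
  then have "n \<le> Suc (nat k)"
    by (auto dest: dvd_imp_le)
  then show ?thesis
    using assms(1) by auto
qed

text \<open>If the nonzero vector \<open>(b1, b2)\<close> is an eigenvector for \<open>r\<close> of the diagonal matrix with entries \<open>X\<close> and
  \<open>Y = X\<^sup>-\<^sup>1\<close>, then \<open>r\<close> is one of the entries and \<open>s = r\<^sup>-\<^sup>1\<close> the other. As \<open>r\<close> and \<open>s\<close> are distinct,
  eigenvectors for \<open>r\<close> and for \<open>s\<close> lie on the corresponding coordinate axes.\<close>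

lemma eigen_cases:
  assumes XY: "[X * Y = 1] (mod int p)"
    and dvd: "int p dvd (X - r) * b1" "int p dvd (Y - r) * b2" "int p dvd (X - s) * c1" "int p dvd (Y - s) * c2"
    and b: "\<not> (int p dvd b1 \<and> int p dvd b2)"
  obtains "[X = r] (mod int p)" "[Y = s] (mod int p)" "int p dvd b2" "int p dvd c1"
    | "[X = s] (mod int p)" "[Y = r] (mod int p)" "int p dvd b1" "int p dvd c2"
proof -
  have "Factorial_Ring.prime (int p)"
    using prime_p by simp
  with dvd have c: "[X = r] (mod int p) \<or> int p dvd b1" "[Y = r] (mod int p) \<or> int p dvd b2"
    "[X = s] (mod int p) \<or> int p dvd c1" "[Y = s] (mod int p) \<or> int p dvd c2"
    by (auto simp: prime_dvd_mult_iff cong_iff_dvd_diff)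
  have neq: "\<not> ([Z = r] (mod int p) \<and> [Z = s] (mod int p))" for Z
    using r_neq_s by (metis cong_sym cong_trans)
  show thesis
  proof (cases "int p dvd b1")
    case True
    then have Y: "[Y = r] (mod int p)"
      using b c(2) by blast
    then have "[X = s] (mod int p)"
      using inverse_unique_cong[of Y X "int p" r s] XY rs by (simp add: mult.commute)
    then show thesis
      using that(2) Y True c neq by blast
  next
    case False
    then have X: "[X = r] (mod int p)"
      using c(1) by blast
    then have "[Y = s] (mod int p)"
      using inverse_unique_cong[of X Y "int p" r s] XY rs by simp
    then show thesis
      using that(1) X False c neq by blast
  qed
qed

text \<open>The images of \<open>gen_b\<close> and \<open>gen_c\<close> stay in \<open>\<int>\<^sub>p \<times> \<int>\<^sub>p\<close> by torsion and are eigenvectors for the action of the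
  image of \<open>gen_a\<close>. Hence an automorphism either preserves both axes and fixes \<open>gen_a\<close> modulo
  \<open>\<int>\<^sub>p \<times> \<int>\<^sub>p\<close>, or exchanges the axes and inverts \<open>gen_a\<close> there.\<close>

lemma auto_K_cases:
  assumes F: "F \<in> auto K"
  obtains (diagonal) v w x y where "F gen_a = ((v, w), 1)" "F gen_b = ((x, 0), 0)" "F gen_c = ((0, y), 0)"
      "v \<in> {0..<int p}" "w \<in> {0..<int p}" "x \<in> {1..<int p}" "y \<in> {1..<int p}"
  | (antidiagonal) v w x y where "F gen_a = ((v, w), int n - 1)" "F gen_b = ((0, y), 0)" "F gen_c = ((x, 0), 0)"
      "v \<in> {0..<int p}" "w \<in> {0..<int p}" "x \<in> {1..<int p}" "y \<in> {1..<int p}"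
proof -
  interpret F: group_hom K K F
    using autoD(1)[OF F] by unfold_locales
  obtain v w k b1 b2 i c1 c2 j
    where eqs: "F gen_a = ((v, w), k)" "F gen_b = ((b1, b2), i)" "F gen_c = ((c1, c2), j)"
    by (metis prod.exhaust)
  have ranges: "v \<in> {0..<int p}" "w \<in> {0..<int p}" "k \<in> {0..<int n}"
    "b1 \<in> {0..<int p}" "b2 \<in> {0..<int p}" "c1 \<in> {0..<int p}" "c2 \<in> {0..<int p}"
    using gens_closed[THEN autoD(5)[OF F]] by (auto simp: eqs carrier_Zp carrier_Zn)
  have "F gen_b [^]\<^bsub>K\<^esub> p = \<one>\<^bsub>K\<^esub>" "F gen_c [^]\<^bsub>K\<^esub> p = \<one>\<^bsub>K\<^esub>"
    using gens_closed F.hom_nat_pow[of gen_b p] F.hom_nat_pow[of gen_c p] p_gt_1 F.hom_one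
    by (simp_all add: pow_inl)
  then have ij: "i = 0" "j = 0"
    using torsion_K gens_closed(2,3)[THEN autoD(5)[OF F]] eqs by (metis snd_conv)+
  have "F gen_b \<noteq> \<one>\<^bsub>K\<^esub>" "F gen_c \<noteq> \<one>\<^bsub>K\<^esub>"
    using F.hom_one autoD(4)[OF F] gens_closed K.one_closed by (metis inj_onD one_semidirect one_DirProd one_integer_mod_group prod.inject zero_neq_one)+
  then have nz: "\<not> (b1 = 0 \<and> b2 = 0)" "\<not> (c1 = 0 \<and> c2 = 0)"
    using eqs ij by auto
  have dvd0: "x = 0" if "x \<in> {0..<int p}" "int p dvd x" for x
    using that by (auto dest: zdvd_imp_le)
  \<comment> \<open>The defining relations of \<open>K\<close> carry over to the images of the generators.\<close>
  have "F gen_a \<otimes>\<^bsub>K\<^esub> F gen_b = F gen_b [^]\<^bsub>K\<^esub> r \<otimes>\<^bsub>K\<^esub> F gen_a"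
    "F gen_a \<otimes>\<^bsub>K\<^esub> F gen_c = F gen_c [^]\<^bsub>K\<^esub> s \<otimes>\<^bsub>K\<^esub> F gen_a"
    using relations_K[THEN arg_cong[of _ _ F]] gens_closed
    by (simp_all add: F.hom_int_pow del: carrier_semidirect mult_semidirect)
  note rel = this[unfolded eqs ij]
  note dvd = eigen_relation[OF ranges(4,5,1,2) rel(1)] eigen_relation[OF ranges(6,7,1,2) rel(2)]
  have XY: "[r ^ nat k * s ^ nat k = 1] (mod int p)"
    by (rule rs_power)
  have "\<not> (int p dvd b1 \<and> int p dvd b2)"
    using nz dvd0 ranges by blast
  from XY dvd this show thesis
  proof (cases rule: eigen_cases)
    case 1
    have "k = 1"
      using power_eq_r ranges 1 by blast
    moreover have "b2 = 0" "c1 = 0"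
      using 1 dvd0 ranges by blast+
    ultimately show thesis
      using diagonal[of v w b1 c2] eqs ij nz ranges by auto
  next
    case 2
    have "k = int n - 1"
      using power_eq_s ranges 2 by blast
    moreover have "b1 = 0" "c2 = 0"
      using 2 dvd0 ranges by blast+
    ultimately show thesis
      using antidiagonal[of v w b2 c1] eqs ij nz ranges by auto
  qed
qed

lemma not_cong_1:
  assumes "k = 1 \<or> k = int n - 1"
  shows "\<not> [r ^ nat k = 1] (mod int p)" "\<not> [s ^ nat k = 1] (mod int p)"
  using assms n_gt_2 by (auto simp: r_order s_order dest: dvd_imp_le)

text \<open>How a monomial matrix acts on the complement \<open>\<int>\<^sub>n\<close>: antidiagonal matrices exchange the eigenvalues \<open>r\<close>
  and \<open>s = r\<^sup>-\<^sup>1\<close>, so they must be paired with inversion.\<close>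

definition sign_action :: "int \<Rightarrow> int \<Rightarrow> int" where
  "sign_action t = (\<lambda>i\<in>carrier (integer_mod_group n). if t = 0 then i else (- i) mod int n)"

lemma sign_action_hom: "sign_action \<in> hom (integer_mod_group 2) (AutoGroup (integer_mod_group n))"
proof (rule hom_AutoGroupI)
  show "sign_action t \<in> auto (integer_mod_group n)" if "t \<in> carrier (integer_mod_group 2)" for t
  proof (rule autoI)
    show "sign_action t \<in> hom (integer_mod_group n) (integer_mod_group n)"
      using n_pos by (intro homI) (auto simp: sign_action_def carrier_integer_mod_group mod_simps)
    have inv: "sign_action t (sign_action t i) = i" "sign_action t i \<in> carrier (integer_mod_group n)"
      if "i \<in> carrier (integer_mod_group n)" for i
      using that n_pos by (auto simp: sign_action_def carrier_integer_mod_group mod_simps)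
    then show "bij_betw (sign_action t) (carrier (integer_mod_group n)) (carrier (integer_mod_group n))"
      by (intro bij_betw_byWitness[where f' = "sign_action t"]) auto
  qed (simp add: sign_action_def)
next
  fix t t' i
  assume "t \<in> carrier (integer_mod_group 2)" "t' \<in> carrier (integer_mod_group 2)"
    "i \<in> carrier (integer_mod_group n)"
  then show "sign_action (t \<otimes>\<^bsub>integer_mod_group 2\<^esub> t') i = sign_action t (sign_action t' i)"
    unfolding integer_mod_group_2
    using n_pos by (auto simp: sign_action_def carrier_integer_mod_group mod_simps)
qed simp

end

section \<open>The automorphism group as a semidirect product\<close>

locale diagonal_action_root = diagonal_action +
  fixes g :: nat
  assumes primroot: "residue_primroot p g"
begin

interpretation K: group K by (rule group_K)

lemma g_coprime: "coprime (int g) (int p)"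
  using primroot by (simp add: residue_primroot_def coprime_commute)

lemma g_power: "[int g ^ (p - 1) = 1] (mod int p)"
proof -
  have "[g ^ (p - 1) = 1] (mod p)"
    using primroot ord[of g p] totient_prime[OF prime_p] by (simp add: residue_primroot_def)
  then show ?thesis
    by (metis cong_int_iff of_nat_1 of_nat_power)
qed

lemma g_bij: "bij_betw (\<lambda>e. int g ^ nat e mod int p) {0..<int (p - 1)} {1..<int p}"
proof -
  have *: "bij_betw (\<lambda>e. g ^ e mod p) {..<p - 1} {0<..<p}"
    using residue_primroot_is_generator[OF p_gt_1 primroot]
    by (simp add: totient_prime[OF prime_p] totatives_prime[OF prime_p])
  have "bij_betw nat {0..<int (p - 1)} {..<p - 1}"
    by (rule bij_betw_byWitness[where f' = int]) auto
  note bij_betw_trans[OF this *]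
  moreover have "bij_betw int {0<..<p} {1..<int p}"
    by (rule bij_betw_byWitness[where f' = nat]) auto
  ultimately have "bij_betw (int \<circ> ((\<lambda>e. g ^ e mod p) \<circ> nat)) {0..<int (p - 1)} {1..<int p}"
    by (rule bij_betw_trans)
  then show ?thesis
    by (simp add: o_def zmod_int)
qed

text \<open>The monomial matrices over \<open>\<int>\<^sub>p\<close>, parametrised by the exponents of their entries with respect to a
  primitive root.\<close>

definition \<psi> :: "(int \<times> int) \<times> int \<Rightarrow> int \<times> int \<Rightarrow> int \<times> int" where
  "\<psi> = (\<lambda>((e, f), t). monomial p (int g ^ nat e) (int g ^ nat f) t)"

lemma psi_hom: "\<psi> \<in> hom (monomial_group (p - 1)) (AutoGroup (plane p))"
proof (rule hom_AutoGroupI)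
  fix h h' v
  assume h: "h \<in> carrier (monomial_group (p - 1))" "h' \<in> carrier (monomial_group (p - 1))"
    and v: "v \<in> carrier (plane p)"
  obtain e f t e' f' t' where eq: "h = ((e, f), t)" "h' = ((e', f'), t')"
    by (metis prod.exhaust)
  have ef: "e \<in> {0..<int (p - 1)}" "f \<in> {0..<int (p - 1)}" "e' \<in> {0..<int (p - 1)}" "f' \<in> {0..<int (p - 1)}"
    and t: "t \<in> {0, 1}" "t' \<in> {0, 1}"
    using h p_pos by (auto simp: eq carrier_integer_mod_group)
  have pow: "[int g ^ nat ((i + j) mod int (p - 1)) = int g ^ nat i * int g ^ nat j] (mod int p)"
    if "i \<in> {0..<int (p - 1)}" "j \<in> {0..<int (p - 1)}" for i j
    using that by (intro power_nat_add_mod_cong g_power) auto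
  show "\<psi> (h \<otimes>\<^bsub>monomial_group (p - 1)\<^esub> h') v = \<psi> h (\<psi> h' v)"
  proof (cases "t = 0")
    case True
    then show ?thesis
      using t ef monomial_cong[OF pow[OF ef(1,3)] pow[OF ef(2,4)], of "t' mod 2"] p_pos
      by (simp add: eq \<psi>_def swap_action_def monomial_monomial[OF p_pos(1) v] monomial_apply)
  next
    case False
    then show ?thesis
      using t ef monomial_cong[OF pow[OF ef(1,4)] pow[OF ef(2,3)], of "(t + t') mod 2"] p_pos
      by (simp add: eq \<psi>_def swap_action_def monomial_monomial[OF p_pos(1) v] monomial_apply)
  qed
next
  show "\<psi> h \<in> auto (plane p)" if "h \<in> carrier (monomial_group (p - 1))" for h
    using that g_coprime p_pos
    by (auto simp: \<psi>_def integer_mod_group_2 intro!: monomial_auto)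
qed (rule group_monomial_group[OF p_pos(2)])

text \<open>Conjugating the diagonal matrix of \<open>i\<close> by an antidiagonal one exchanges the entries \<open>r\<^sup>i\<close> and \<open>s\<^sup>i\<close>, which
  gives the diagonal matrix of \<open>- i\<close>.\<close>

lemma psi_theta:
  assumes h: "h \<in> carrier (monomial_group (p - 1))" and v: "v \<in> carrier (plane p)"
    and i: "i \<in> carrier (integer_mod_group n)"
  shows "\<psi> h (\<theta> i v) = \<theta> (sign_action (snd h) i) (\<psi> h v)"
proof -
  obtain e f t where eq: "h = ((e, f), t)"
    by (metis prod.exhaust)
  have t: "t \<in> {0, 1}"
    using h by (auto simp: eq integer_mod_group_2)
  have i': "0 \<le> i" "i < int n"
    using i n_pos by (auto simp: carrier_integer_mod_group)
  have neg: "[x ^ nat i * x ^ nat ((- i) mod int n) = 1] (mod int p)" if "[x ^ n = 1] (mod int p)" for x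
    using power_nat_add_mod_cong[OF that i'(1), of "(- i) mod int n"] n_pos
    by (simp add: mod_simps cong_sym)
  have "[s ^ nat i = r ^ nat ((- i) mod int n)] (mod int p)"
    using inverse_unique_cong[OF rs_power[of "nat i"] neg[of r]] by (simp add: r_order)
  moreover have "[r ^ nat i = s ^ nat ((- i) mod int n)] (mod int p)"
    using inverse_unique_cong[OF _ neg[of s], of "s ^ nat i"] rs_power[of "nat i"]
    by (simp add: s_order mult.commute)
  ultimately have "monomial p (int g ^ nat e * s ^ nat i) (int g ^ nat f * r ^ nat i) 1 =
      monomial p (r ^ nat ((- i) mod int n) * int g ^ nat e) (s ^ nat ((- i) mod int n) * int g ^ nat f) 1"
    by (intro monomial_cong) (metis cong_scalar_left mult.commute)+
  then show ?thesis
    using t i by (auto simp: eq \<psi>_def \<theta>_def sign_action_def monomial_monomial[OF p_pos(1) v] mult.commute)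
qed

definition extend :: "(int \<times> int) \<times> int \<Rightarrow> (int \<times> int) \<times> int \<Rightarrow> (int \<times> int) \<times> int" where
  "extend h = restrict (\<lambda>(v, i). (\<psi> h v, sign_action (snd h) i)) (carrier (plane p) \<times> carrier (integer_mod_group n))"

lemma extend_hom: "extend \<in> hom (monomial_group (p - 1)) (AutoGroup K)"
proof -
  have "sign_action \<circ> snd \<in> hom (monomial_group (p - 1)) (AutoGroup (integer_mod_group n))"
    using semidirect_snd_hom sign_action_hom by (rule hom_compose)
  from semidirect_pair_hom[OF group_plane _ theta_hom psi_hom this] psi_theta
  show ?thesis
    unfolding extend_def by simp
qed

text \<open>Inner automorphisms by elements of \<open>\<int>\<^sub>p \<times> \<int>\<^sub>p\<close>. They replace explicit automorphisms \<open>a \<mapsto> v a\<close>, whose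
  formulas would involve geometric sums.\<close>

definition translate :: "int \<times> int \<Rightarrow> (int \<times> int) \<times> int \<Rightarrow> (int \<times> int) \<times> int" where
  "translate v = conjugation K (v, 0)"

lemma translate_hom: "translate \<in> hom (plane p) (AutoGroup K)"
proof -
  have "(\<lambda>v. (v, 0)) \<in> hom (plane p) K"
    using semidirect_inl_hom[OF group_plane _ theta_hom] by simp
  then have "conjugation K \<circ> (\<lambda>v. (v, 0)) \<in> hom (plane p) (AutoGroup K)"
    using group.conjugation_hom[OF group_K] by (rule hom_compose)
  then show ?thesis
    by (simp add: o_def translate_def[abs_def])
qed

definition \<Theta> :: "(int \<times> int) \<times> (int \<times> int) \<times> int \<Rightarrow> (int \<times> int) \<times> int \<Rightarrow> (int \<times> int) \<times> int" where
  "\<Theta> = (\<lambda>(v, h). translate v \<otimes>\<^bsub>AutoGroup K\<^esub> extend h)"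

text \<open>An extended monomial map conjugates the inner automorphism of \<open>v\<close> to that of the image of \<open>v\<close>, so
  the semidirect product is formed with the natural action of monomial matrices.\<close>

lemma Theta_hom: "\<Theta> \<in> hom (semidirect (plane p) (monomial_group (p - 1)) \<psi>) (AutoGroup K)"
  unfolding \<Theta>_def
proof (rule semidirect_hom)
  interpret K: group K by (rule group_K)
  fix v h assume v: "v \<in> carrier (plane p)" and h: "h \<in> carrier (monomial_group (p - 1))"
  show "\<psi> h v \<in> carrier (plane p)"
    using monomial_closed[OF p_pos(1) v] by (simp add: \<psi>_def split: prod.split)
  have "extend h \<in> auto K"
    using h extend_hom by (auto simp: hom_def carrier_AutoGroup)
  moreover have "extend h (v, 0) = (\<psi> h v, 0)"
    using v n_pos by (simp add: extend_def sign_action_def del: carrier_DirProd)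
  ultimately show "extend h \<otimes>\<^bsub>AutoGroup K\<^esub> translate v = translate (\<psi> h v) \<otimes>\<^bsub>AutoGroup K\<^esub> extend h"
    using K.auto_conjugation[of "extend h" "(v, 0)"] v by (simp add: translate_def)
qed (intro group.AutoGroup group_K group_plane translate_hom extend_hom)+

lemma Theta_apply:
  assumes v: "v \<in> carrier (plane p)" and h: "h \<in> carrier (monomial_group (p - 1))"
    and w: "w \<in> carrier (plane p)" and i: "i \<in> carrier (integer_mod_group n)"
  shows "\<Theta> (v, h) (w, i) =
    (v \<otimes>\<^bsub>plane p\<^esub> \<psi> h w \<otimes>\<^bsub>plane p\<^esub> \<theta> (sign_action (snd h) i) (inv\<^bsub>plane p\<^esub> v), sign_action (snd h) i)"
proof -
  interpret V: group "plane p" by (rule group_plane)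
  have auto: "translate v \<in> auto K" "extend h \<in> auto K"
    using translate_hom extend_hom v h by (auto simp: hom_def carrier_AutoGroup)
  have "inv\<^bsub>K\<^esub> (v, 0) = (inv\<^bsub>plane p\<^esub> v, 0)"
    using v by (intro K.inv_equality) (auto simp: theta_0 simp del: carrier_DirProd mult_DirProd one_DirProd)
  moreover have "(\<psi> h w, sign_action (snd h) i) \<in> carrier K"
    using autoD(5)[OF auto(2), of "(w, i)"] w i by (simp add: extend_def)
  moreover have "extend h (w, i) = (\<psi> h w, sign_action (snd h) i)"
    using w i by (simp add: extend_def)
  ultimately show ?thesis
    using v w i auto n_pos
    by (auto simp: \<Theta>_def mult_AutoGroup compose_def translate_def conjugation_def theta_0 carrier_integer_mod_group[of n]
        simp del: carrier_DirProd mult_DirProd one_DirProd)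
qed

text \<open>The three values show how the parameters are read off: the images of \<open>gen_b\<close> and \<open>gen_c\<close> determine the
  monomial matrix, and the image of \<open>gen_a\<close> then determines the inner part.\<close>

lemma Theta_gens:
  assumes x: "x \<in> {0..<int p}" "y \<in> {0..<int p}" and h: "((e, f), t) \<in> carrier (monomial_group (p - 1))"
  shows "\<Theta> ((x, y), ((e, f), t)) gen_b =
      (if t = 0 then ((int g ^ nat e mod int p, 0), 0) else ((0, int g ^ nat f mod int p), 0))"
    and "\<Theta> ((x, y), ((e, f), t)) gen_c =
      (if t = 0 then ((0, int g ^ nat f mod int p), 0) else ((int g ^ nat e mod int p, 0), 0))"
    and "\<Theta> ((x, y), ((e, f), t)) gen_a =
      (let k = if t = 0 then 1 else int n - 1
       in (((x - r ^ nat k * x) mod int p, (y - s ^ nat k * y) mod int p), k))"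
proof -
  have V: "(x, y) \<in> carrier (plane p)" "(1, 0) \<in> carrier (plane p)" "(0, 1) \<in> carrier (plane p)" "(0, 0) \<in> carrier (plane p)"
    and H: "0 \<in> carrier (integer_mod_group n)" "1 \<in> carrier (integer_mod_group n)"
    using x p_gt_1 n_gt_2 by (auto simp: carrier_integer_mod_group)
  have inv: "inv\<^bsub>plane p\<^esub> (x, y) = ((- x) mod int p, (- y) mod int p)"
    using V(1) by (simp add: inv_DirProd)
  have sign: "sign_action t 0 = 0" "sign_action t 1 = (if t = 0 then 1 else int n - 1)"
    using H n_gt_2 by (auto simp: sign_action_def zmod_minus1)
  have theta: "\<theta> k ((- x) mod int p, (- y) mod int p) =
      ((- (r ^ nat k * x)) mod int p, (- (s ^ nat k * y)) mod int p)" for k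
    using p_pos by (simp add: theta_apply mod_simps)
  note simps = Theta_apply[OF V(1) h] V H inv sign theta \<psi>_def
  show "\<Theta> ((x, y), ((e, f), t)) gen_b =
      (if t = 0 then ((int g ^ nat e mod int p, 0), 0) else ((0, int g ^ nat f mod int p), 0))"
    "\<Theta> ((x, y), ((e, f), t)) gen_c =
      (if t = 0 then ((0, int g ^ nat f mod int p), 0) else ((int g ^ nat e mod int p, 0), 0))"
    "\<Theta> ((x, y), ((e, f), t)) gen_a =
      (let k = if t = 0 then 1 else int n - 1
       in (((x - r ^ nat k * x) mod int p, (y - s ^ nat k * y) mod int p), k))"
    using p_gt_1 n_gt_2 by (simp_all add: simps monomial_apply mod_simps Let_def del: carrier_DirProd)
qed

lemma Theta_inj: "inj_on \<Theta> (carrier (semidirect (plane p) (monomial_group (p - 1)) \<psi>))"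
proof (rule inj_onI)
  fix z z'
  assume z: "z \<in> carrier (semidirect (plane p) (monomial_group (p - 1)) \<psi>)"
    "z' \<in> carrier (semidirect (plane p) (monomial_group (p - 1)) \<psi>)" and eq: "\<Theta> z = \<Theta> z'"
  obtain x y e f t x' y' e' f' t' where zz: "z = ((x, y), ((e, f), t))" "z' = ((x', y'), ((e', f'), t'))"
    by (metis prod.exhaust)
  have h: "((e, f), t) \<in> carrier (monomial_group (p - 1))" "((e', f'), t') \<in> carrier (monomial_group (p - 1))"
    and t: "t \<in> {0, 1}" "t' \<in> {0, 1}"
    and ef: "e \<in> {0..<int (p - 1)}" "f \<in> {0..<int (p - 1)}" "e' \<in> {0..<int (p - 1)}" "f' \<in> {0..<int (p - 1)}"
    and xy: "x \<in> {0..<int p}" "y \<in> {0..<int p}" "x' \<in> {0..<int p}" "y' \<in> {0..<int p}"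
    using z p_pos by (auto simp: zz carrier_Zp carrier_integer_mod_group)
  have gt: "int g ^ nat d mod int p \<noteq> 0" if "d \<in> {0..<int (p - 1)}" for d
    using bij_betwE[OF g_bij] that by fastforce
  have ginj: "d = d'" if "int g ^ nat d mod int p = int g ^ nat d' mod int p"
    "d \<in> {0..<int (p - 1)}" "d' \<in> {0..<int (p - 1)}" for d d'
    using g_bij that by (auto simp: bij_betw_def inj_on_def)
  note gens = Theta_gens[OF xy(1,2) h(1)] Theta_gens[OF xy(3,4) h(2)]
  have b: "\<Theta> z gen_b = \<Theta> z' gen_b" and c: "\<Theta> z gen_c = \<Theta> z' gen_c" and a: "\<Theta> z gen_a = \<Theta> z' gen_a"
    by (simp_all add: eq)
  \<comment> \<open>The images of \<open>gen_b\<close> lie on different axes for different \<open>t\<close>, and powers of \<open>g\<close> do not vanish.\<close>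
  have "t = t'"
    using b t gt[OF ef(1)] gt[OF ef(3)] unfolding zz gens by (auto split: if_splits)
  have "int g ^ nat e mod int p = int g ^ nat e' mod int p" "int g ^ nat f mod int p = int g ^ nat f' mod int p"
    using b c unfolding zz gens unfolding \<open>t = t'\<close> by (simp_all split: if_splits)
  then have "e = e'" "f = f'"
    using ginj ef by blast+
  define k where "k = (if t' = 0 then 1 else int n - 1)"
  have "(x - r ^ nat k * x) mod int p = (x' - r ^ nat k * x') mod int p"
    "(y - s ^ nat k * y) mod int p = (y' - s ^ nat k * y') mod int p"
    using a unfolding zz gens unfolding \<open>t = t'\<close> Let_def k_def[symmetric] by simp_all
  moreover have "\<not> [r ^ nat k = 1] (mod int p)" "\<not> [s ^ nat k = 1] (mod int p)"
    using not_cong_1[of k] by (auto simp: k_def)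
  ultimately have "x = x'" "y = y'"
    using fixed_point_equation_inj[OF prime_p] xy by blast+
  then show "z = z'"
    using \<open>t = t'\<close> \<open>e = e'\<close> \<open>f = f'\<close> by (simp add: zz)
qed

text \<open>By \<open>auto_K_cases\<close> the images of the generators have the shape of \<open>Theta_gens\<close>; exponents come from the
  primitive root, the inner part from \<open>solve_fixed_point_equation\<close>.\<close>

lemma Theta_surj:
  assumes F: "F \<in> auto K"
  shows "F \<in> \<Theta> ` carrier (semidirect (plane p) (monomial_group (p - 1)) \<psi>)"
proof -
  have "\<exists>z \<in> carrier (semidirect (plane p) (monomial_group (p - 1)) \<psi>).
    F gen_a = \<Theta> z gen_a \<and> F gen_b = \<Theta> z gen_b \<and> F gen_c = \<Theta> z gen_c" (is ?ex)
  proof -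
    have root: "\<exists>e \<in> {0..<int (p - 1)}. int g ^ nat e mod int p = x" if "x \<in> {1..<int p}" for x
    proof -
      have "x \<in> (\<lambda>e. int g ^ nat e mod int p) ` {0..<int (p - 1)}"
        using g_bij that by (simp add: bij_betw_def)
      then show ?thesis by blast
    qed
    have ex: ?ex
      if "t \<in> {0, 1}" "k = (if t = 0 then 1 else int n - 1)" "F gen_a = ((v, w), k)"
        "F gen_b = (if t = 0 then ((x, 0), 0) else ((0, y), 0))"
        "F gen_c = (if t = 0 then ((0, y), 0) else ((x, 0), 0))"
        and vw: "v \<in> {0..<int p}" "w \<in> {0..<int p}" and xy: "x \<in> {1..<int p}" "y \<in> {1..<int p}"
      for t k v w x y :: int
    proof -
      obtain e f where ef: "e \<in> {0..<int (p - 1)}" "f \<in> {0..<int (p - 1)}"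
        and x: "int g ^ nat e mod int p = x" and y: "int g ^ nat f mod int p = y"
        using root[OF xy(1)] root[OF xy(2)] by blast
      have k: "\<not> [r ^ nat k = 1] (mod int p)" "\<not> [s ^ nat k = 1] (mod int p)"
        using not_cong_1 that(2) by (auto split: if_splits)
      obtain v' where v': "v' \<in> {0..<int p}" "(v' - r ^ nat k * v') mod int p = v"
        using solve_fixed_point_equation[OF prime_p k(1) vw(1)] by blast
      obtain w' where w': "w' \<in> {0..<int p}" "(w' - s ^ nat k * w') mod int p = w"
        using solve_fixed_point_equation[OF prime_p k(2) vw(2)] by blast
      have h: "((e, f), t) \<in> carrier (monomial_group (p - 1))"
        using ef that(1) p_pos by (auto simp: carrier_integer_mod_group)
      show ?ex
      proof (intro bexI[of _ "((v', w'), ((e, f), t))"] conjI)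
        show "F gen_a = \<Theta> ((v', w'), ((e, f), t)) gen_a"
          unfolding Theta_gens(3)[OF v'(1) w'(1) h] Let_def that(2)[symmetric] using that(3) v'(2) w'(2) by simp
        show "F gen_b = \<Theta> ((v', w'), ((e, f), t)) gen_b" "F gen_c = \<Theta> ((v', w'), ((e, f), t)) gen_c"
          unfolding Theta_gens(1,2)[OF v'(1) w'(1) h] x y using that(4,5) by auto
        show "((v', w'), ((e, f), t)) \<in> carrier (semidirect (plane p) (monomial_group (p - 1)) \<psi>)"
          using h v' w' by (simp add: carrier_Zp)
      qed
    qed
    from F show ?ex
    proof (cases rule: auto_K_cases)
      case (diagonal v w x y)
      then show ?thesis by (intro ex[of 0 1 v w x y]) auto
    next
      case (antidiagonal v w x y)
      then show ?thesis by (intro ex[of 1 "int n - 1" v w x y]) auto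
    qed
  qed
  then obtain z where z: "z \<in> carrier (semidirect (plane p) (monomial_group (p - 1)) \<psi>)"
    and eq: "F gen_a = \<Theta> z gen_a" "F gen_b = \<Theta> z gen_b" "F gen_c = \<Theta> z gen_c"
    by blast
  have "\<Theta> z \<in> auto K"
    using z Theta_hom by (auto simp: hom_def carrier_AutoGroup)
  then have "F = \<Theta> z"
    using F by (intro auto_eqI[of F K] hom_K_eq[OF group_K _ _ eq]) (auto dest: autoD(1))
  then show ?thesis
    using z by blast
qed

lemma AutoGroup_K_iso: "AutoGroup K \<cong> semidirect (plane p) (monomial_group (p - 1)) \<psi>"
proof -
  have "\<Theta> ` carrier (semidirect (plane p) (monomial_group (p - 1)) \<psi>) = carrier (AutoGroup K)"
    using Theta_hom Theta_surj unfolding carrier_AutoGroup hom_def by blast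
  then have "\<Theta> \<in> iso (semidirect (plane p) (monomial_group (p - 1)) \<psi>) (AutoGroup K)"
    using Theta_hom Theta_inj by (simp add: iso_iff)
  moreover have "group (semidirect (plane p) (monomial_group (p - 1)) \<psi>)"
    using p_pos by (intro group_semidirect group_plane group_monomial_group psi_hom) simp
  ultimately show ?thesis
    using group.iso_sym is_isoI by blast
qed

end

section \<open>The theorem\<close>

theorem mainTheorem9:
  fixes p q :: nat and r s :: int
  assumes "Factorial_Ring.prime p" and "Factorial_Ring.prime q" and "p \<noteq> q" and "p * q \<noteq> 6"
    and "q ^ 2 dvd p - 1"
    and "ord (int p) r = q ^ 2"
    and "[r * s = 1] (mod int p)"
  shows "\<exists>\<phi> \<psi>.
    \<phi> \<in> hom (integer_mod_group 2)
            (AutoGroup (integer_mod_group (p - 1) \<times>\<times> integer_mod_group (p - 1))) \<and>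
    \<psi> \<in> hom (semidirect (integer_mod_group (p - 1) \<times>\<times> integer_mod_group (p - 1))
                        (integer_mod_group 2) \<phi>)
            (AutoGroup (integer_mod_group p \<times>\<times> integer_mod_group p)) \<and>
    AutoGroup (G_group p q r s) \<cong>
      semidirect (integer_mod_group p \<times>\<times> integer_mod_group p)
        (semidirect (integer_mod_group (p - 1) \<times>\<times> integer_mod_group (p - 1))
                    (integer_mod_group 2) \<phi>) \<psi>"
proof -
  have q: "q \<ge> 2"
    using assms(2) by (rule prime_ge_2_nat)
  have q2: "q\<^sup>2 > 2"
    using power_mono[OF q, of 2] by simp
  have order: "[r ^ k = 1] (mod int p) \<longleftrightarrow> q\<^sup>2 dvd k" for k
    using int_ord_divides[of p r k] assms(1,6) by (simp add: prime_gt_0_nat)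
  obtain g where "residue_primroot p g"
    using prime_primitive_root_exists[of p] assms(1) prime_gt_1_nat by blast
  then interpret diagonal_action_root p "q\<^sup>2" r s g
    using assms(1,5,7) q2 order by unfold_locales auto
  have "AutoGroup (G_group p q r s) \<cong> AutoGroup K"
    using G_group_iso_K[OF refl] group_K by (intro AutoGroup_iso_cong)
  also note AutoGroup_K_iso
  finally show ?thesis
    using swap_action_hom[OF p_pos(2)] psi_hom by blast
qed

end
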